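(* Suppose that all variables of the integer bilevel nonlinear program are binary (and that the standing assumptions in the context hold). Then the disjunctive cuts can be used in the cutting-plane algorithm described in the context, in which the relaxation is solved to optimality before bilevel-infeasible solutions are separated, and this procedure is finitely convergent: each binary optimal solution obtained is an extreme point of the convex hull of the feasible set of $\overline{\mathrm{HPR}}$, and thus a violated cut will be produced by the separation if this solution is not bilevel feasible.
   Context: **Bilevel program.** Prime denotes transpose, $n=n_1+n_2$. The integer bilevel nonlinear program (IBNP) is $$\min\ c'x+d'y\quad\text{s.t. } Mx+Ny\ge h,\ \ \tilde Mx+\tilde Ny-\tilde h\in\mathcal K,\ \ y\in\Omega(x),\ \ x\in\mathbb Z^{n_1},$$ where $\Omega(x)$ is the set of optimal solutions of the follower problem $\min\{q(y): y\in F(x)\}$, $F(x)=\{y\in\mathbb Z^{n_2}: Ax+By\ge f,\ y\in\mathcal Y\}$. Here $A\in\mathbb Z^{m_2\times n_1}$, $B\in\mathbb Z^{m_2\times n_2}$, $f\in\mathbb Z^{m_2}$ with $i$-th rows/entries $A^i,B^i,f_i$ (each $A^i$ and $B^i$ has a nonzero entry); the other data are real; $\mathcal K$ is a cross-product of second-order cones; $\mathcal Y$ is a polyhedron; $q(y)=y'Ry+g'y$ with $R=V'V$, $V\in\mathbb R^{n_3\times n_2}$, $n_3\le n_2$. "All variables are binary" means that $x$ and $y$ are restricted to $0/1$ values. A point $(x,y)$ is bilevel feasible if it satisfies all constraints of the IBNP, otherwise bilevel infeasible. **Relaxations.** The high-point relaxation (HPR) is $\min\{c'x+d'y: Mx+Ny\ge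 h,\ \tilde Mx+\tilde Ny-\tilde h\in\mathcal K,\ Ax+By\ge f,\ y\in\mathcal Y,\ (x,y)\in\mathbb Z^n\}$ (with binary variables here); its continuous relaxation $\overline{\mathrm{HPR}}$ replaces the integrality constraint by the corresponding variable bound constraints. **Disjunctive cuts.** For a set $\mathcal P=\{(x,y):\bar Mx+\bar Ny\ge\bar h,\ \tilde Mx+\tilde Ny-\tilde h\in\mathcal K\}$ contained in the feasible set of $\overline{\mathrm{HPR}}$ and $\hat y\in\mathcal Y\cap\mathbb Z^{n_2}$, let $\mathcal D_0(\hat y)$ be the condition $q(y)\le q(\hat y)$, equivalently $\tilde Dy-\tilde c\in\mathcal Q$ with $\mathcal Q=\{(z^0,z^1,z^2):z^0\ge\|(z^1,z^2)\|_2\}$, $$\tilde D=\begin{pmatrix}-\tfrac12 g'\\ V\\ \tfrac12 g'\end{pmatrix},\qquad \tilde c=\begin{pmatrix}\tfrac{-1-q(\hat y)}2\\ 0\\ \tfrac{-1+q(\hat y)}2\end{pmatrix},$$ and for $i=1,\dots,m_2$ let $\mathcal D_i(\hat y)$ be the condition $A^ix\le f_i-B^i\hat y-1$. Put $\mathcal D(\hat y,\mathcal P)=\operatorname{conv}\big(\bigcup_{i=0}^{m_2}\{(x,y)\in\mathcal P:\mathcal D_i(\hat y)\text{ holds}\}\big)$. (CG-SOCP) is: maximize $\tau-\alpha'x^*-\beta'y^*$ subject to $\alpha'=\bar\pi_i'\bar M+\tilde\pi_i'\tilde M+\sigma_iA^i$ ($i=1,\dots,m_2$); $\alpha'=\bar\pi_0'\bar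 M+\tilde\pi_0'\tilde M$; $\beta'=\bar\pi_i'\bar N+\tilde\pi_i'\tilde N$ ($i=1,\dots,m_2$); $\beta'=\bar\pi_0'\bar N+\tilde\pi_0'\tilde N+\rho'\tilde D$; $\tau\le\bar\pi_i'\bar h+\tilde\pi_i'\tilde h+\sigma_i(f_i-1-B^i\hat y)$ ($i=1,\dots,m_2$); $\tau\le\bar\pi_0'\bar h+\tilde\pi_0'\tilde h+\rho'\tilde c$; $\sigma\le0$, $\rho\in\mathcal Q^*$, $\bar\pi_i\ge0$, $\tilde\pi_i\in\mathcal K^*$ ($i=0,\dots,m_2$), where $*$ on a cone denotes the dual cone; since this feasible region is a cone, a normalization constraint is added, e.g. $\|((\bar\pi_i)_i,(\tilde\pi_i)_i,\sigma,\rho)\|_p\le1$ with $p\in\{1,2\}$. A feasible solution with positive objective value gives a disjunctive cut $\alpha'x+\beta'y\ge\tau$, valid for $\mathcal D(\hat y,\mathcal P)$ and violated by $(x^*,y^* )$. **Separation** for $(x^*,y^* )$ and $\mathcal P$, with a fixed $\varepsilon>0$: solve the follower problem for $x=x^*$ by an enumeration-based method; for an optimal $\hat y$ with $q(\hat y)<q(y^* )$ (strategy O), or for each feasible integer $\hat y$ with $q(\hat y)<q(y^* )$ encountered (strategy G), solve (CG-SOCP), and if $\tau-\alpha'x^*-\beta'y^*>\varepsilon$ return the cut $\alpha'x+\beta'y\ge\tau$; if no such cut is found, return nothing. **Cutting-plane algorithm.** Input: an instance of the IBNP in which all variables are binary. Output: an optimal solution $(x^*,y^* )$. Initialize $\mathcal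 R$ as the HPR and $\mathcal P$ as the feasible set of $\overline{\mathrm{HPR}}$. Repeat: solve $\mathcal R$ to optimality, obtaining an optimal solution $(x^*,y^* )$; call separation for $(x^*,y^* )$ and $\mathcal P$ with strategy O or G; if a violated cut is found, add it to $\mathcal R$ and to $\mathcal P$ and repeat; otherwise stop and return $(x^*,y^* )$. **Standing assumptions.** (1) All variables are bounded in the HPR and $\mathcal Y$ is bounded. (2) $\overline{\mathrm{HPR}}$ has a feasible solution satisfying $\tilde Mx+\tilde Ny-\tilde h\in\mathcal K$ strictly, and its dual has a feasible solution. (3) The dual of (CG-SOCP) has a feasible solution in its interior, and an exact solver for (CG-SOCP) is available.
   Formalization: For large ε the normalized (CG-SOCP) may yield no cut with violation above ε; so that a cut is produced at bilevel-infeasible solutions, and that the output is optimal, is stated only for ε up to some ε0>0 depending on the instance; finite termination and cut validity hold for every ε. *)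

theory Defs
  imports "HOL-Analysis.Analysis"
begin

section \<open>Cones\<close>

definition dual_cone :: "'a::real_inner set \<Rightarrow> 'a set" where
  "dual_cone K = {w. \<forall>z\<in>K. 0 \<le> w \<bullet> z}"

text \<open>A cross-product of second-order cones. The coordinates are partitioned into blocks, each
  block being named by its head coordinate: \<open>hd_of j\<close> is the head of the block containing \<open>j\<close>.
  A block with a single coordinate is the cone of nonnegative reals.\<close>

definition is_soc_product :: "(real^'k) set \<Rightarrow> bool" where
  "is_soc_product K \<longleftrightarrow>
     (\<exists>hd_of :: 'k \<Rightarrow> 'k. (\<forall>j. hd_of (hd_of j) = hd_of j) \<and>
        K = {z. \<forall>k. hd_of k = k \<longrightarrow> L2_set (\<lambda>j. z $ j) {j. hd_of j = k \<and> j \<noteq> k} \<le> z $ k})"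

definition soc_Q :: "(real \<times> (real^'n3) \<times> real) set" where
  "soc_Q = {(z0, z1, z2). norm (z1, z2) \<le> z0}"


section \<open>The bilevel program with binary variables\<close>

text \<open>The polyhedron of the follower is \<open>{y. T_Y *v y \<ge> t_Y}\<close>.\<close>

record ('n1::finite, 'n2::finite, 'n3::finite, 'm1::finite, 'm2::finite, 'm3::finite, 'k::finite) ibnp =
  c_obj  :: "real^'n1"
  d_obj  :: "real^'n2"
  M_lead :: "real^'n1^'m1"
  N_lead :: "real^'n2^'m1"
  h_lead :: "real^'m1"
  M_con  :: "real^'n1^'k"
  N_con  :: "real^'n2^'k"
  h_con  :: "real^'k"
  K_con  :: "(real^'k) set"
  A_fol  :: "int^'n1^'m2"
  B_fol  :: "int^'n2^'m2"
  f_fol  :: "int^'m2"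
  T_Y    :: "real^'n2^'m3"
  t_Y    :: "real^'m3"
  V_fol  :: "real^'n2^'n3"
  g_fol  :: "real^'n2"

definition ibnp_data :: "('n1::finite,'n2::finite,'n3::finite,'m1::finite,'m2::finite,'m3::finite,'k::finite) ibnp \<Rightarrow> bool" where
  "ibnp_data I \<longleftrightarrow>
     is_soc_product (K_con I) \<and> CARD('n3) \<le> CARD('n2) \<and>
     (\<forall>i. A_fol I $ i \<noteq> 0) \<and> (\<forall>i. B_fol I $ i \<noteq> 0)"

definition A_real :: "('n1::finite,'n2::finite,'n3::finite,'m1::finite,'m2::finite,'m3::finite,'k::finite) ibnp \<Rightarrow> real^'n1^'m2" where
  "A_real I = (\<chi> i j. real_of_int (A_fol I $ i $ j))"

definition B_real :: "('n1::finite,'n2::finite,'n3::finite,'m1::finite,'m2::finite,'m3::finite,'k::finite) ibnp \<Rightarrow> real^'n2^'m2" where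
  "B_real I = (\<chi> i j. real_of_int (B_fol I $ i $ j))"

definition f_real :: "('n1::finite,'n2::finite,'n3::finite,'m1::finite,'m2::finite,'m3::finite,'k::finite) ibnp \<Rightarrow> real^'m2" where
  "f_real I = (\<chi> i. real_of_int (f_fol I $ i))"

definition poly_Y :: "('n1::finite,'n2::finite,'n3::finite,'m1::finite,'m2::finite,'m3::finite,'k::finite) ibnp \<Rightarrow> (real^'n2) set" where
  "poly_Y I = {y. t_Y I \<le> T_Y I *v y}"

definition q_obj :: "('n1::finite,'n2::finite,'n3::finite,'m1::finite,'m2::finite,'m3::finite,'k::finite) ibnp \<Rightarrow> real^'n2 \<Rightarrow> real" where
  "q_obj I y = y \<bullet> ((transpose (V_fol I) ** V_fol I) *v y) + g_fol I \<bullet> y"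

definition binary_vec :: "real^'n \<Rightarrow> bool" where
  "binary_vec x \<longleftrightarrow> (\<forall>j. x $ j \<in> {0, 1})"

definition leader_obj :: "('n1::finite,'n2::finite,'n3::finite,'m1::finite,'m2::finite,'m3::finite,'k::finite) ibnp \<Rightarrow> (real^'n1) \<times> (real^'n2) \<Rightarrow> real" where
  "leader_obj I = (\<lambda>(x, y). c_obj I \<bullet> x + d_obj I \<bullet> y)"

definition leader_constraints :: "('n1::finite,'n2::finite,'n3::finite,'m1::finite,'m2::finite,'m3::finite,'k::finite) ibnp \<Rightarrow> real^'n1 \<Rightarrow> real^'n2 \<Rightarrow> bool" where
  "leader_constraints I x y \<longleftrightarrow>
     h_lead I \<le> M_lead I *v x + N_lead I *v y \<and>
     M_con I *v x + N_con I *v y - h_con I \<in> K_con I"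

definition follower_feasible :: "('n1::finite,'n2::finite,'n3::finite,'m1::finite,'m2::finite,'m3::finite,'k::finite) ibnp \<Rightarrow> real^'n1 \<Rightarrow> (real^'n2) set" where
  "follower_feasible I x =
     {y. binary_vec y \<and> f_real I \<le> A_real I *v x + B_real I *v y \<and> y \<in> poly_Y I}"

definition follower_optimal :: "('n1::finite,'n2::finite,'n3::finite,'m1::finite,'m2::finite,'m3::finite,'k::finite) ibnp \<Rightarrow> real^'n1 \<Rightarrow> (real^'n2) set" where
  "follower_optimal I x =
     {y \<in> follower_feasible I x. \<forall>w \<in> follower_feasible I x. q_obj I y \<le> q_obj I w}"

definition bilevel_feasible :: "('n1::finite,'n2::finite,'n3::finite,'m1::finite,'m2::finite,'m3::finite,'k::finite) ibnp \<Rightarrow> ((real^'n1) \<times> (real^'n2)) set" where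
  "bilevel_feasible I =
     {(x, y). leader_constraints I x y \<and> y \<in> follower_optimal I x \<and> binary_vec x}"

definition bilevel_optimal :: "('n1::finite,'n2::finite,'n3::finite,'m1::finite,'m2::finite,'m3::finite,'k::finite) ibnp \<Rightarrow> ((real^'n1) \<times> (real^'n2)) set" where
  "bilevel_optimal I =
     {z \<in> bilevel_feasible I. \<forall>w \<in> bilevel_feasible I. leader_obj I z \<le> leader_obj I w}"

definition hpr_feasible :: "('n1::finite,'n2::finite,'n3::finite,'m1::finite,'m2::finite,'m3::finite,'k::finite) ibnp \<Rightarrow> ((real^'n1) \<times> (real^'n2)) set" where
  "hpr_feasible I =
     {(x, y). leader_constraints I x y \<and> f_real I \<le> A_real I *v x + B_real I *v y \<and>
        y \<in> poly_Y I \<and> binary_vec x \<and> binary_vec y}"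

definition hpr_cont_feasible :: "('n1::finite,'n2::finite,'n3::finite,'m1::finite,'m2::finite,'m3::finite,'k::finite) ibnp \<Rightarrow> ((real^'n1) \<times> (real^'n2)) set" where
  "hpr_cont_feasible I =
     {(x, y). leader_constraints I x y \<and> f_real I \<le> A_real I *v x + B_real I *v y \<and>
        y \<in> poly_Y I \<and> (\<forall>j. 0 \<le> x $ j \<and> x $ j \<le> 1) \<and> (\<forall>j. 0 \<le> y $ j \<and> y $ j \<le> 1)}"


section \<open>Row descriptions of the sets \<open>P\<close>\<close>

text \<open>The multipliers of the cut generating problem refer to the individual rows of
  \<open>Mbar x + Nbar y \<ge> hbar\<close>, so \<open>P\<close> is given by such a system (finitely many rows, indexed by
  \<open>rows\<close>) and not just as a set.\<close>

record ('i, 'n1::finite, 'n2::finite) lin_sys =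
  rows :: "'i set"
  Mbar :: "'i \<Rightarrow> real^'n1"
  Nbar :: "'i \<Rightarrow> real^'n2"
  hbar :: "'i \<Rightarrow> real"

definition sys_set :: "('n1::finite,'n2::finite,'n3::finite,'m1::finite,'m2::finite,'m3::finite,'k::finite) ibnp \<Rightarrow>
    ('i,'n1,'n2) lin_sys \<Rightarrow> ((real^'n1) \<times> (real^'n2)) set" where
  "sys_set I S =
     {(x, y). (\<forall>r \<in> rows S. hbar S r \<le> Mbar S r \<bullet> x + Nbar S r \<bullet> y) \<and>
        M_con I *v x + N_con I *v y - h_con I \<in> K_con I}"

text \<open>A cut \<open>\<alpha>'x + \<beta>'y \<ge> \<tau>\<close> is the triple \<open>(\<alpha>, \<beta>, \<tau>)\<close>.\<close>

type_synonym ('n1, 'n2) cut = "(real^'n1) \<times> (real^'n2) \<times> real"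

definition satisfies_cut :: "(real^'n1) \<times> (real^'n2) \<Rightarrow> ('n1::finite, 'n2::finite) cut \<Rightarrow> bool" where
  "satisfies_cut = (\<lambda>(x, y) (\<alpha>, \<beta>, \<tau>). \<tau> \<le> \<alpha> \<bullet> x + \<beta> \<bullet> y)"

datatype ('n1, 'n2, 'm1, 'm2, 'm3) row_ix =
  LeaderRow 'm1 | FollowerRow 'm2 | YRow 'm3 |
  XLower 'n1 | XUpper 'n1 | YLower 'n2 | YUpper 'n2 | CutRow nat

definition P_sys :: "('n1::finite,'n2::finite,'n3::finite,'m1::finite,'m2::finite,'m3::finite,'k::finite) ibnp \<Rightarrow>
    ('n1,'n2) cut list \<Rightarrow> (('n1,'n2,'m1,'m2,'m3) row_ix, 'n1, 'n2) lin_sys" where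
  "P_sys I cs =
     \<lparr> rows = {r. case r of CutRow k \<Rightarrow> k < length cs | _ \<Rightarrow> True},
       Mbar = (\<lambda>r. case r of
           LeaderRow i \<Rightarrow> M_lead I $ i | FollowerRow i \<Rightarrow> A_real I $ i | YRow i \<Rightarrow> 0
         | XLower j \<Rightarrow> axis j 1 | XUpper j \<Rightarrow> - axis j 1 | YLower j \<Rightarrow> 0 | YUpper j \<Rightarrow> 0
         | CutRow k \<Rightarrow> fst (cs ! k)),
       Nbar = (\<lambda>r. case r of
           LeaderRow i \<Rightarrow> N_lead I $ i | FollowerRow i \<Rightarrow> B_real I $ i | YRow i \<Rightarrow> T_Y I $ i
         | XLower j \<Rightarrow> 0 | XUpper j \<Rightarrow> 0 | YLower j \<Rightarrow> axis j 1 | YUpper j \<Rightarrow> - axis j 1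
         | CutRow k \<Rightarrow> fst (snd (cs ! k))),
       hbar = (\<lambda>r. case r of
           LeaderRow i \<Rightarrow> h_lead I $ i | FollowerRow i \<Rightarrow> f_real I $ i | YRow i \<Rightarrow> t_Y I $ i
         | XLower j \<Rightarrow> 0 | XUpper j \<Rightarrow> -1 | YLower j \<Rightarrow> 0 | YUpper j \<Rightarrow> -1
         | CutRow k \<Rightarrow> snd (snd (cs ! k))) \<rparr>"

lemma all_row_ix:
  "(\<forall>r. Q r) \<longleftrightarrow> (\<forall>i. Q (LeaderRow i)) \<and> (\<forall>i. Q (FollowerRow i)) \<and> (\<forall>i. Q (YRow i)) \<and>
     (\<forall>i. Q (XLower i)) \<and> (\<forall>i. Q (XUpper i)) \<and> (\<forall>i. Q (YLower i)) \<and> (\<forall>i. Q (YUpper i)) \<and>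
     (\<forall>i. Q (CutRow i))" (is "?L \<longleftrightarrow> ?R")
proof
  assume ?R
  then show ?L
    by (intro allI, rename_tac r, case_tac r) blast+
qed blast

lemma sys_set_P_sys:
  fixes I :: "('n1::finite,'n2::finite,'n3::finite,'m1::finite,'m2::finite,'m3::finite,'k::finite) ibnp"
  shows "sys_set I (P_sys I cs) = {z \<in> hpr_cont_feasible I. \<forall>c \<in> set cs. satisfies_cut z c}"
proof (rule set_eqI)
  fix z :: "(real^'n1) \<times> (real^'n2)"
  obtain x y where z: "z = (x, y)" by (cases z)
  let ?S = "P_sys I cs"
  let ?Q = "\<lambda>r. r \<in> rows ?S \<longrightarrow> hbar ?S r \<le> Mbar ?S r \<bullet> x + Nbar ?S r \<bullet> y"
  have 1: "(\<forall>i. ?Q (LeaderRow i)) \<longleftrightarrow> h_lead I \<le> M_lead I *v x + N_lead I *v y"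
    "(\<forall>i. ?Q (FollowerRow i)) \<longleftrightarrow> f_real I \<le> A_real I *v x + B_real I *v y"
    "(\<forall>i. ?Q (YRow i)) \<longleftrightarrow> y \<in> poly_Y I"
    by (simp_all add: P_sys_def less_eq_vec_def matrix_vector_mul_component poly_Y_def)
  have 2: "(\<forall>i. ?Q (XLower i)) \<longleftrightarrow> (\<forall>j. 0 \<le> x $ j)" "(\<forall>i. ?Q (XUpper i)) \<longleftrightarrow> (\<forall>j. x $ j \<le> 1)"
    "(\<forall>i. ?Q (YLower i)) \<longleftrightarrow> (\<forall>j. 0 \<le> y $ j)" "(\<forall>i. ?Q (YUpper i)) \<longleftrightarrow> (\<forall>j. y $ j \<le> 1)"
    by (simp_all add: P_sys_def inner_axis')
  have 3: "(\<forall>i. ?Q (CutRow i)) \<longleftrightarrow> (\<forall>c \<in> set cs. satisfies_cut z c)"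
    by (simp add: P_sys_def z satisfies_cut_def all_set_conv_all_nth case_prod_unfold)
  have "z \<in> sys_set I ?S \<longleftrightarrow> (\<forall>r. ?Q r) \<and> M_con I *v x + N_con I *v y - h_con I \<in> K_con I"
    by (simp add: sys_set_def z Ball_def)
  also have "\<dots> \<longleftrightarrow> z \<in> hpr_cont_feasible I \<and> (\<forall>c \<in> set cs. satisfies_cut z c)"
    unfolding all_row_ix[of ?Q] 1 2 3 by (auto simp: z hpr_cont_feasible_def leader_constraints_def)
  finally show "z \<in> sys_set I ?S \<longleftrightarrow> z \<in> {z \<in> hpr_cont_feasible I. \<forall>c \<in> set cs. satisfies_cut z c}"
    by simp
qed


section \<open>Disjunctive cuts\<close>

definition Dtil :: "('n1::finite,'n2::finite,'n3::finite,'m1::finite,'m2::finite,'m3::finite,'k::finite) ibnp \<Rightarrow> real^'n2 \<Rightarrow> real \<times> (real^'n3) \<times> real" where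
  "Dtil I y = (- (1/2) * (g_fol I \<bullet> y), V_fol I *v y, (1/2) * (g_fol I \<bullet> y))"

definition Dtil_transpose :: "('n1::finite,'n2::finite,'n3::finite,'m1::finite,'m2::finite,'m3::finite,'k::finite) ibnp \<Rightarrow> real \<times> (real^'n3) \<times> real \<Rightarrow> real^'n2" where
  "Dtil_transpose I = (\<lambda>(r0, r1, r2).
     (- (1/2) * r0) *\<^sub>R g_fol I + transpose (V_fol I) *v r1 + ((1/2) * r2) *\<^sub>R g_fol I)"

definition ctil :: "('n1::finite,'n2::finite,'n3::finite,'m1::finite,'m2::finite,'m3::finite,'k::finite) ibnp \<Rightarrow> real^'n2 \<Rightarrow> real \<times> (real^'n3) \<times> real" where
  "ctil I yh = ((- 1 - q_obj I yh) / 2, 0, (- 1 + q_obj I yh) / 2)"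

lemma inner_Dtil: "r \<bullet> Dtil I y = Dtil_transpose I r \<bullet> y"
proof (cases r)
  case (fields r0 r1 r2)
  have "r1 \<bullet> (V_fol I *v y) = (transpose (V_fol I) *v r1) \<bullet> y"
    by (simp add: dot_lmul_matrix)
  then show ?thesis
    by (simp add: fields Dtil_def Dtil_transpose_def inner_add_left algebra_simps)
qed

lemma Dtil_in_soc_Q_iff: "Dtil I y - ctil I yh \<in> soc_Q \<longleftrightarrow> q_obj I y \<le> q_obj I yh"
proof -
  let ?a = "V_fol I *v y" and ?t = "g_fol I \<bullet> y" and ?q = "q_obj I yh"
  have "y \<bullet> ((transpose (V_fol I) ** V_fol I) *v y) = ?a \<bullet> ?a"
    by (simp add: matrix_vector_mul_assoc[symmetric] dot_lmul_matrix inner_commute[of y])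
  then have q: "q_obj I y = (norm ?a)\<^sup>2 + ?t"
    by (simp add: q_obj_def power2_norm_eq_inner)
  have e: "Dtil I y - ctil I yh = ((1 + ?q - ?t) / 2, ?a, (?t + 1 - ?q) / 2)"
    by (simp add: Dtil_def ctil_def field_simps)
  have "Dtil I y - ctil I yh \<in> soc_Q \<longleftrightarrow>
      sqrt ((norm ?a)\<^sup>2 + ((?t + 1 - ?q) / 2)\<^sup>2) \<le> (1 + ?q - ?t) / 2"
    unfolding e by (simp add: soc_Q_def norm_Pair)
  also have "\<dots> \<longleftrightarrow> (norm ?a)\<^sup>2 \<le> ?q - ?t"
  proof
    assume "sqrt ((norm ?a)\<^sup>2 + ((?t + 1 - ?q) / 2)\<^sup>2) \<le> (1 + ?q - ?t) / 2"
    then have "(norm ?a)\<^sup>2 + ((?t + 1 - ?q) / 2)\<^sup>2 \<le> ((1 + ?q - ?t) / 2)\<^sup>2"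
      by (rule sqrt_le_D)
    then show "(norm ?a)\<^sup>2 \<le> ?q - ?t"
      by (simp add: power2_eq_square field_simps)
  next
    assume r: "(norm ?a)\<^sup>2 \<le> ?q - ?t"
    then have "0 \<le> ?q - ?t"
      by (meson order_trans zero_le_power2)
    then show "sqrt ((norm ?a)\<^sup>2 + ((?t + 1 - ?q) / 2)\<^sup>2) \<le> (1 + ?q - ?t) / 2"
      using r by (intro real_le_lsqrt) (auto simp: power2_eq_square field_simps)
  qed
  also have "\<dots> \<longleftrightarrow> q_obj I y \<le> ?q"
    using q by auto
  finally show ?thesis .
qed

definition disj_rhs :: "('n1::finite,'n2::finite,'n3::finite,'m1::finite,'m2::finite,'m3::finite,'k::finite) ibnp \<Rightarrow> real^'n2 \<Rightarrow> 'm2 \<Rightarrow> real" where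
  "disj_rhs I yh i = f_real I $ i - 1 - B_real I $ i \<bullet> yh"

text \<open>The \<open>m2 + 1\<close> terms of the disjunction are indexed by \<open>None\<close> (term 0) and \<open>Some i\<close>.\<close>

definition disj_term :: "('n1::finite,'n2::finite,'n3::finite,'m1::finite,'m2::finite,'m3::finite,'k::finite) ibnp \<Rightarrow> real^'n2 \<Rightarrow> 'm2 option \<Rightarrow>
    (real^'n1) \<times> (real^'n2) \<Rightarrow> bool" where
  "disj_term I yh t = (\<lambda>(x, y). case t of
      None \<Rightarrow> q_obj I y \<le> q_obj I yh
    | Some i \<Rightarrow> A_real I $ i \<bullet> x \<le> disj_rhs I yh i)"

definition disj_hull :: "('n1::finite,'n2::finite,'n3::finite,'m1::finite,'m2::finite,'m3::finite,'k::finite) ibnp \<Rightarrow> real^'n2 \<Rightarrow>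
    ((real^'n1) \<times> (real^'n2)) set \<Rightarrow> ((real^'n1) \<times> (real^'n2)) set" where
  "disj_hull I yh P = convex hull (\<Union>t. {z \<in> P. disj_term I yh t z})"

record ('i, 'n3::finite, 'm2::finite, 'k::finite) mult =
  pbar :: "'m2 option \<Rightarrow> 'i \<Rightarrow> real"
  ptil :: "'m2 option \<Rightarrow> real^'k"
  sig  :: "real^'m2"
  rho  :: "real \<times> (real^'n3) \<times> real"

text \<open>The \<open>p\<close>-norm of all multipliers, where only the entries of \<open>pbar\<close> on the row set \<open>X\<close> count.\<close>

definition mult_norm :: "nat \<Rightarrow> 'i set \<Rightarrow> ('i,'n3::finite,'m2::finite,'k::finite) mult \<Rightarrow> real" where
  "mult_norm p X m = root p
     ((\<Sum>t\<in>UNIV. \<Sum>r\<in>X. \<bar>pbar m t r\<bar> ^ p) + (\<Sum>t\<in>UNIV. \<Sum>k\<in>UNIV. \<bar>ptil m t $ k\<bar> ^ p)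
      + (\<Sum>i\<in>UNIV. \<bar>sig m $ i\<bar> ^ p)
      + (case rho m of (r0, r1, r2) \<Rightarrow> \<bar>r0\<bar> ^ p + (\<Sum>l\<in>UNIV. \<bar>r1 $ l\<bar> ^ p) + \<bar>r2\<bar> ^ p))"

text \<open>The dual norm for \<open>p \<in> {1, 2}\<close>: the maximum norm for \<open>p = 1\<close>, the Euclidean one for \<open>p = 2\<close>.\<close>

definition mult_dual_norm :: "nat \<Rightarrow> 'i set \<Rightarrow> ('i,'n3::finite,'m2::finite,'k::finite) mult \<Rightarrow> real" where
  "mult_dual_norm p X m =
     (if p = 1 then
        Max ({\<bar>pbar m t r\<bar> | t r. r \<in> X} \<union> {\<bar>ptil m t $ k\<bar> | t k. True} \<union> {\<bar>sig m $ i\<bar> | i. True}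
          \<union> (case rho m of (r0, r1, r2) \<Rightarrow> {\<bar>r0\<bar>, \<bar>r2\<bar>} \<union> {\<bar>r1 $ l\<bar> | l. True}))
      else mult_norm 2 X m)"

definition cg_feasible :: "('n1::finite,'n2::finite,'n3::finite,'m1::finite,'m2::finite,'m3::finite,'k::finite) ibnp \<Rightarrow>
    ('i,'n1,'n2) lin_sys \<Rightarrow> nat \<Rightarrow> real^'n2 \<Rightarrow> ('n1,'n2) cut \<Rightarrow> ('i,'n3,'m2,'k) mult \<Rightarrow> bool" where
  "cg_feasible I S p yh = (\<lambda>(\<alpha>, \<beta>, \<tau>) m.
     (\<forall>i. \<alpha> = (\<Sum>r\<in>rows S. pbar m (Some i) r *\<^sub>R Mbar S r)
              + transpose (M_con I) *v ptil m (Some i) + sig m $ i *\<^sub>R A_real I $ i) \<and>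
     \<alpha> = (\<Sum>r\<in>rows S. pbar m None r *\<^sub>R Mbar S r) + transpose (M_con I) *v ptil m None \<and>
     (\<forall>i. \<beta> = (\<Sum>r\<in>rows S. pbar m (Some i) r *\<^sub>R Nbar S r)
              + transpose (N_con I) *v ptil m (Some i)) \<and>
     \<beta> = (\<Sum>r\<in>rows S. pbar m None r *\<^sub>R Nbar S r) + transpose (N_con I) *v ptil m None
           + Dtil_transpose I (rho m) \<and>
     (\<forall>i. \<tau> \<le> (\<Sum>r\<in>rows S. pbar m (Some i) r * hbar S r) + ptil m (Some i) \<bullet> h_con I
              + sig m $ i * disj_rhs I yh i) \<and>
     \<tau> \<le> (\<Sum>r\<in>rows S. pbar m None r * hbar S r) + ptil m None \<bullet> h_con I + rho m \<bullet> ctil I yh \<and>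
     (\<forall>i. sig m $ i \<le> 0) \<and> rho m \<in> dual_cone soc_Q \<and>
     (\<forall>t. \<forall>r\<in>rows S. 0 \<le> pbar m t r) \<and> (\<forall>t. ptil m t \<in> dual_cone (K_con I)) \<and>
     mult_norm p (rows S) m \<le> 1)"

definition cut_violation :: "(real^'n1) \<times> (real^'n2) \<Rightarrow> ('n1::finite, 'n2::finite) cut \<Rightarrow> real" where
  "cut_violation = (\<lambda>(x, y) (\<alpha>, \<beta>, \<tau>). \<tau> - \<alpha> \<bullet> x - \<beta> \<bullet> y)"

definition cg_optimal :: "('n1::finite,'n2::finite,'n3::finite,'m1::finite,'m2::finite,'m3::finite,'k::finite) ibnp \<Rightarrow>
    ('i,'n1,'n2) lin_sys \<Rightarrow> nat \<Rightarrow> real^'n2 \<Rightarrow> (real^'n1) \<times> (real^'n2) \<Rightarrow> ('n1,'n2) cut \<Rightarrow> bool" where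
  "cg_optimal I S p yh z c \<longleftrightarrow>
     (\<exists>m. cg_feasible I S p yh c m) \<and>
     (\<forall>c' m'. cg_feasible I S p yh c' m' \<longrightarrow> cut_violation z c' \<le> cut_violation z c)"

definition disjunctive_cut :: "('n1::finite,'n2::finite,'n3::finite,'m1::finite,'m2::finite,'m3::finite,'k::finite) ibnp \<Rightarrow>
    ((real^'n1) \<times> (real^'n2)) set \<Rightarrow> (real^'n1) \<times> (real^'n2) \<Rightarrow> ('n1,'n2) cut \<Rightarrow> bool" where
  "disjunctive_cut I P z c \<longleftrightarrow>
     (\<exists>yh. yh \<in> poly_Y I \<and> binary_vec yh \<and> (\<forall>w \<in> disj_hull I yh P. satisfies_cut w c)) \<and>
     \<not> satisfies_cut z c"


section \<open>Standing assumptions\<close>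

definition hpr_cont_slater :: "('n1::finite,'n2::finite,'n3::finite,'m1::finite,'m2::finite,'m3::finite,'k::finite) ibnp \<Rightarrow> bool" where
  "hpr_cont_slater I \<longleftrightarrow>
     (\<exists>(x, y) \<in> hpr_cont_feasible I. M_con I *v x + N_con I *v y - h_con I \<in> interior (K_con I))"

definition hpr_cont_dual_feasible :: "('n1::finite,'n2::finite,'n3::finite,'m1::finite,'m2::finite,'m3::finite,'k::finite) ibnp \<Rightarrow> bool" where
  "hpr_cont_dual_feasible I \<longleftrightarrow> (let S = P_sys I [] in
     \<exists>u w. (\<forall>r\<in>rows S. 0 \<le> u r) \<and> w \<in> dual_cone (K_con I) \<and>
       (\<Sum>r\<in>rows S. u r *\<^sub>R Mbar S r) + transpose (M_con I) *v w = c_obj I \<and>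
       (\<Sum>r\<in>rows S. u r *\<^sub>R Nbar S r) + transpose (N_con I) *v w = d_obj I)"

text \<open>The conic dual of the normalized cut generating problem minimizes \<open>s\<close>. Its variables are
  \<open>u t\<close>, \<open>v t\<close>, \<open>l t\<close>, the multipliers of the equations for \<open>\<alpha>\<close> and \<open>\<beta>\<close> and of the bounds on
  \<open>\<tau>\<close>, and the multiplier \<open>(s, om)\<close> of the normalization constraint, which lies in the dual norm
  cone. Without the normalization (that is, \<open>om = 0\<close>), feasibility of the dual would exclude
  violated cuts. Being in the interior means satisfying all conic constraints strictly.\<close>

definition cg_dual_interior_point :: "('n1::finite,'n2::finite,'n3::finite,'m1::finite,'m2::finite,'m3::finite,'k::finite) ibnp \<Rightarrow>
    ('i,'n1,'n2) lin_sys \<Rightarrow> nat \<Rightarrow> real^'n2 \<Rightarrow> (real^'n1) \<times> (real^'n2) \<Rightarrow> bool" where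
  "cg_dual_interior_point I S p yh = (\<lambda>(x, y).
     \<exists>(u :: 'm2 option \<Rightarrow> real^'n1) (v :: 'm2 option \<Rightarrow> real^'n2) (l :: 'm2 option \<Rightarrow> real)
        (om :: ('i,'n3,'m2,'k) mult) s.
       (\<Sum>t\<in>UNIV. u t) = x \<and> (\<Sum>t\<in>UNIV. v t) = y \<and> (\<Sum>t\<in>UNIV. l t) = 1 \<and>
       (\<forall>t. 0 < l t) \<and>
       (\<forall>t. \<forall>r\<in>rows S. 0 < Mbar S r \<bullet> u t + Nbar S r \<bullet> v t - l t * hbar S r + pbar om t r) \<and>
       (\<forall>t. M_con I *v u t + N_con I *v v t - l t *\<^sub>R h_con I + ptil om t \<in> interior (K_con I)) \<and>
       (\<forall>i. A_real I $ i \<bullet> u (Some i) - l (Some i) * disj_rhs I yh i + sig om $ i < 0) \<and>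
       Dtil I (v None) - l None *\<^sub>R ctil I yh + rho om \<in> interior soc_Q \<and>
       mult_dual_norm p (rows S) om < s)"

definition standing_assumptions :: "('n1::finite,'n2::finite,'n3::finite,'m1::finite,'m2::finite,'m3::finite,'k::finite) ibnp \<Rightarrow> bool" where
  "standing_assumptions I \<longleftrightarrow>
     bounded (hpr_feasible I) \<and> bounded (poly_Y I) \<and>
     hpr_cont_slater I \<and> hpr_cont_dual_feasible I \<and>
     (\<forall>cs p yh z. p \<in> {1, 2} \<and> yh \<in> poly_Y I \<and> binary_vec yh \<and> z \<in> hpr_feasible I \<longrightarrow>
        cg_dual_interior_point I (P_sys I cs) p yh z)"


section \<open>Separation and the cutting-plane algorithm\<close>

datatype strategy = Strategy_O | Strategy_G

text \<open>\<open>E\<close> is a possible set of follower solutions handed over by the enumeration-based method for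
  the follower problem at \<open>x\<close>. With strategy O this is one optimal solution. With strategy G it
  consists of all feasible solutions encountered, an optimal one among them, since the
  method solves the problem to optimality.\<close>

definition enumerated :: "('n1::finite,'n2::finite,'n3::finite,'m1::finite,'m2::finite,'m3::finite,'k::finite) ibnp \<Rightarrow> strategy \<Rightarrow>
    real^'n1 \<Rightarrow> (real^'n2) set \<Rightarrow> bool" where
  "enumerated I st x E \<longleftrightarrow> (case st of
      Strategy_O \<Rightarrow> \<exists>yh \<in> follower_optimal I x. E = {yh}
    | Strategy_G \<Rightarrow> E \<subseteq> follower_feasible I x \<and> E \<inter> follower_optimal I x \<noteq> {})"

text \<open>Possible outcomes of a separation call; optimal solutions of the follower problem and of the
  cut generating problem need not be unique, hence a relation.\<close>

inductive separation :: "('n1::finite,'n2::finite,'n3::finite,'m1::finite,'m2::finite,'m3::finite,'k::finite) ibnp \<Rightarrow> strategy \<Rightarrow> nat \<Rightarrow> real \<Rightarrow>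
    ('i,'n1,'n2) lin_sys \<Rightarrow> (real^'n1) \<times> (real^'n2) \<Rightarrow> ('n1,'n2) cut option \<Rightarrow> bool"
  for I st p \<epsilon> S where
  found: "enumerated I st x E \<Longrightarrow> yh \<in> E \<Longrightarrow> q_obj I yh < q_obj I y \<Longrightarrow>
     cg_optimal I S p yh (x, y) c \<Longrightarrow> \<epsilon> < cut_violation (x, y) c \<Longrightarrow>
     separation I st p \<epsilon> S (x, y) (Some c)"
| nothing: "enumerated I st x E \<Longrightarrow>
     (\<And>yh. yh \<in> E \<Longrightarrow> q_obj I yh < q_obj I y \<Longrightarrow>
        \<exists>c. cg_optimal I S p yh (x, y) c \<and> cut_violation (x, y) c \<le> \<epsilon>) \<Longrightarrow>
     separation I st p \<epsilon> S (x, y) None"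

text \<open>The state of the algorithm is the list \<open>cs\<close> of cuts added so far, to both \<open>R\<close> and \<open>P\<close>.\<close>

definition R_feasible :: "('n1::finite,'n2::finite,'n3::finite,'m1::finite,'m2::finite,'m3::finite,'k::finite) ibnp \<Rightarrow> ('n1,'n2) cut list \<Rightarrow>
    ((real^'n1) \<times> (real^'n2)) set" where
  "R_feasible I cs = {z \<in> hpr_feasible I. \<forall>c \<in> set cs. satisfies_cut z c}"

definition R_optimal :: "('n1::finite,'n2::finite,'n3::finite,'m1::finite,'m2::finite,'m3::finite,'k::finite) ibnp \<Rightarrow> ('n1,'n2) cut list \<Rightarrow>
    ((real^'n1) \<times> (real^'n2)) set" where
  "R_optimal I cs =
     {z \<in> R_feasible I cs. \<forall>w \<in> R_feasible I cs. leader_obj I z \<le> leader_obj I w}"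

definition cp_step :: "('n1::finite,'n2::finite,'n3::finite,'m1::finite,'m2::finite,'m3::finite,'k::finite) ibnp \<Rightarrow> strategy \<Rightarrow> nat \<Rightarrow> real \<Rightarrow>
    ('n1,'n2) cut list \<Rightarrow> ('n1,'n2) cut list \<Rightarrow> bool" where
  "cp_step I st p \<epsilon> cs cs' \<longleftrightarrow>
     (\<exists>z \<in> R_optimal I cs. \<exists>c. separation I st p \<epsilon> (P_sys I cs) z (Some c) \<and> cs' = cs @ [c])"

definition cp_reachable :: "('n1::finite,'n2::finite,'n3::finite,'m1::finite,'m2::finite,'m3::finite,'k::finite) ibnp \<Rightarrow> strategy \<Rightarrow> nat \<Rightarrow> real \<Rightarrow>
    ('n1,'n2) cut list \<Rightarrow> bool" where
  "cp_reachable I st p \<epsilon> cs \<longleftrightarrow> rtranclp (cp_step I st p \<epsilon>) [] cs"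

definition cp_returns :: "('n1::finite,'n2::finite,'n3::finite,'m1::finite,'m2::finite,'m3::finite,'k::finite) ibnp \<Rightarrow> strategy \<Rightarrow> nat \<Rightarrow> real \<Rightarrow>
    (real^'n1) \<times> (real^'n2) \<Rightarrow> bool" where
  "cp_returns I st p \<epsilon> z \<longleftrightarrow>
     (\<exists>cs. cp_reachable I st p \<epsilon> cs \<and> z \<in> R_optimal I cs \<and>
        separation I st p \<epsilon> (P_sys I cs) z None)"

definition cp_terminates :: "('n1::finite,'n2::finite,'n3::finite,'m1::finite,'m2::finite,'m3::finite,'k::finite) ibnp \<Rightarrow> strategy \<Rightarrow> nat \<Rightarrow> real \<Rightarrow> bool" where
  "cp_terminates I st p \<epsilon> \<longleftrightarrow>
     \<not> (\<exists>run. run 0 = [] \<and> (\<forall>k. cp_step I st p \<epsilon> (run k) (run (Suc k))))"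

end

theory Submission
  imports Defs
begin

text \<open>A binary point \<open>z\<close> of the relaxation is an extreme point of the hull of its continuous
  feasible set, so it lies in the hull of the disjunction only if it satisfies one of the terms. If
  \<open>yh\<close> is follower feasible at \<open>z\<close> and strictly better than the follower part of \<open>z\<close>, no term holds
  at \<open>z\<close>, and a hyperplane separates \<open>z\<close> strictly from the compact hull. The strict inequality is
  turned into exact multipliers term by term: separating an affine image of the unit box from the
  cone gives multipliers up to a linear form on the box, and the bound rows absorb this form.

  Such multipliers do not use the rows of added cuts, so after scaling they give a positive
  lower bound on the optimal violation that depends only on \<open>p\<close>, \<open>z\<close> and \<open>yh\<close>. There are finitely
  many such triples, hence one \<open>\<epsilon>0\<close> works for all runs. Every cut removes a binary point and,
  by integrality of the follower data, no bilevel feasible one.\<close>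

subsection \<open>Conic certificates\<close>

text \<open>The common interface of orthants, \<open>soc_Q\<close> and \<open>K_con\<close>:
  products stay in the class, so one separation argument treats all constraints of a disjunct at
  once.\<close>

definition closed_convex_cone :: "'a::real_inner set \<Rightarrow> bool" where
  "closed_convex_cone C \<longleftrightarrow> closed C \<and> convex C \<and> 0 \<in> C \<and> (\<forall>x\<in>C. \<forall>c\<ge>0. c *\<^sub>R x \<in> C)"

lemma closed_convex_cone_Times:
  assumes "closed_convex_cone C" "closed_convex_cone D"
  shows "closed_convex_cone (C \<times> D)"
  using assms by (auto simp: closed_convex_cone_def zero_prod_def intro: closed_Times convex_Times)

lemma closed_convex_cone_nonneg_vec: "closed_convex_cone {z :: real^'n. 0 \<le> z}"
proof -
  have "{z :: real^'n. 0 \<le> z} = (\<Inter>i. {z. 0 \<le> z $ i})"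
    by (auto simp: less_eq_vec_def)
  moreover have "closed {z :: real^'n. 0 \<le> z $ i}" "convex {z :: real^'n. 0 \<le> z $ i}" for i
    using closed_halfspace_ge[of 0 "axis i (1::real)"] convex_halfspace_ge[of 0 "axis i (1::real)"]
    by (auto simp: inner_axis')
  ultimately have "closed {z :: real^'n. 0 \<le> z}" "convex {z :: real^'n. 0 \<le> z}"
    by (auto intro!: closed_INT convex_INT)
  then show ?thesis
    by (auto simp: closed_convex_cone_def less_eq_vec_def)
qed

lemma closed_convex_cone_nonneg_real: "closed_convex_cone {0::real..}"
  by (auto simp: closed_convex_cone_def)

section \<open>Dual cones of products and orthants\<close>

lemma dual_cone_Times:
  assumes "0 \<in> C" "0 \<in> D"
  shows "dual_cone (C \<times> D) = dual_cone C \<times> dual_cone D"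
proof (intro equalityI subsetI)
  fix w assume w: "w \<in> dual_cone (C \<times> D)"
  \<comment> \<open>Test vectors that vanish in the other factor isolate one component of
    \<open>w\<close>.\<close>
  have "0 \<le> fst w \<bullet> z" if "z \<in> C" for z
    using w that assms bspec[of "C \<times> D" "\<lambda>k. 0 \<le> w \<bullet> k" "(z, 0)"]
    by (simp add: dual_cone_def inner_prod_def)
  moreover have "0 \<le> snd w \<bullet> z" if "z \<in> D" for z
    using w that assms bspec[of "C \<times> D" "\<lambda>k. 0 \<le> w \<bullet> k" "(0, z)"]
    by (simp add: dual_cone_def inner_prod_def)
  ultimately show "w \<in> dual_cone C \<times> dual_cone D"
    by (cases w) (auto simp: dual_cone_def)
qed (auto simp: dual_cone_def inner_prod_def)

lemma dual_cone_nonneg_vec: "dual_cone {z :: real^'n. 0 \<le> z} = {z. 0 \<le> z}"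
proof (intro equalityI subsetI)
  fix w :: "real^'n" assume w: "w \<in> dual_cone {z. 0 \<le> z}"
  have "0 \<le> w $ i" for i
  proof -
    have "0 \<le> w \<bullet> axis i 1"
      using w by (auto simp: dual_cone_def less_eq_vec_def axis_def)
    then show ?thesis by (simp add: inner_axis)
  qed
  then show "w \<in> {z. 0 \<le> z}" by (simp add: less_eq_vec_def)
qed (auto simp: dual_cone_def less_eq_vec_def inner_vec_def intro!: sum_nonneg)

lemma dual_cone_nonneg_real: "dual_cone {0::real..} = {0..}"
  by (auto simp: dual_cone_def dest: bspec[of _ _ 1])

lemma dual_cone_scaleR: "w \<in> dual_cone C \<Longrightarrow> 0 \<le> c \<Longrightarrow> c *\<^sub>R w \<in> dual_cone C"
  by (simp add: dual_cone_def)

lemma closed_dual_cone: "closed (dual_cone C)"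
proof -
  have "dual_cone C = (\<Inter>z\<in>C. {w. 0 \<le> w \<bullet> z})"
    by (auto simp: dual_cone_def)
  moreover have "closed {w. 0 \<le> w \<bullet> z}" for z :: 'a
    by (intro closed_Collect_le continuous_intros)
  ultimately show ?thesis by auto
qed

text \<open>Each block compares a seminorm with a coordinate: continuity gives closedness, the
  triangle inequality convexity, and homogeneity the scaling.\<close>

lemma closed_convex_cone_soc_product:
  assumes "is_soc_product K"
  shows "closed_convex_cone K"
proof -
  from assms obtain hd_of :: "'a \<Rightarrow> 'a" where
    K: "K = {z. \<forall>k. hd_of k = k \<longrightarrow> L2_set (\<lambda>j. z $ j) {j. hd_of j = k \<and> j \<noteq> k} \<le> z $ k}"
    unfolding is_soc_product_def by blast
  let ?n = "\<lambda>z :: real^'a. \<lambda>k. L2_set (\<lambda>j. z $ j) {j. hd_of j = k \<and> j \<noteq> k}"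
  have "closed K"
    unfolding K L2_set_def
    by (intro closed_Collect_all closed_Collect_imp open_Collect_const closed_Collect_le
        continuous_intros)
  moreover have "convex K"
  proof (rule convexI)
    fix x y and u v :: real
    assume xy: "x \<in> K" "y \<in> K" and uv: "0 \<le> u" "0 \<le> v" "u + v = 1"
    have "?n (u *\<^sub>R x + v *\<^sub>R y) k \<le> (u *\<^sub>R x + v *\<^sub>R y) $ k" if k: "hd_of k = k" for k
    proof -
      have "?n (u *\<^sub>R x + v *\<^sub>R y) k \<le> ?n (u *\<^sub>R x) k + ?n (v *\<^sub>R y) k"
        using L2_set_triangle_ineq[of "\<lambda>j. (u *\<^sub>R x) $ j" "\<lambda>j. (v *\<^sub>R y) $ j"] by simp
      also have "\<dots> = u * ?n x k + v * ?n y k"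
        using uv by (simp add: L2_set_right_distrib)
      also have "\<dots> \<le> u * x $ k + v * y $ k"
        using xy uv k by (intro add_mono mult_left_mono) (auto simp: K)
      finally show ?thesis by simp
    qed
    then show "u *\<^sub>R x + v *\<^sub>R y \<in> K" unfolding K by blast
  qed
  moreover have "0 \<in> K" by (simp add: K L2_set_def)
  moreover have "c *\<^sub>R x \<in> K" if x: "x \<in> K" and c: "0 \<le> c" for x c
  proof -
    have "?n (c *\<^sub>R x) k \<le> (c *\<^sub>R x) $ k" if k: "hd_of k = k" for k
    proof -
      have "?n (c *\<^sub>R x) k = c * ?n x k"
        using c by (simp add: L2_set_right_distrib)
      also have "\<dots> \<le> c * x $ k"
        using x c k by (intro mult_left_mono) (auto simp: K)
      finally show ?thesis by simp
    qed
    then show ?thesis unfolding K by blast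
  qed
  ultimately show ?thesis by (simp add: closed_convex_cone_def)
qed

lemma closed_convex_cone_soc_Q: "closed_convex_cone (soc_Q :: (real \<times> (real^'n3) \<times> real) set)"
proof -
  have Q: "(soc_Q :: (real \<times> (real^'n3) \<times> real) set) = {z. norm (snd z) \<le> fst z}"
    by (auto simp: soc_Q_def)
  have "closed {z :: real \<times> (real^'n3) \<times> real. norm (snd z) \<le> fst z}"
    by (intro closed_Collect_le continuous_intros)
  moreover have "convex {z :: real \<times> (real^'n3) \<times> real. norm (snd z) \<le> fst z}"
  proof (rule convexI)
    fix x y :: "real \<times> (real^'n3) \<times> real" and u v :: real
    assume xy: "x \<in> {z. norm (snd z) \<le> fst z}" "y \<in> {z. norm (snd z) \<le> fst z}"
      and uv: "0 \<le> u" "0 \<le> v" "u + v = 1"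
    have "norm (u *\<^sub>R snd x + v *\<^sub>R snd y) \<le> u * norm (snd x) + v * norm (snd y)"
      using norm_triangle_ineq[of "u *\<^sub>R snd x" "v *\<^sub>R snd y"] uv by simp
    also have "\<dots> \<le> u * fst x + v * fst y"
      using xy uv by (intro add_mono mult_left_mono) auto
    finally show "u *\<^sub>R x + v *\<^sub>R y \<in> {z. norm (snd z) \<le> fst z}" by simp
  qed
  ultimately show ?thesis
    unfolding Q closed_convex_cone_def by (auto intro: mult_left_mono)
qed

text \<open>No constraint qualification is needed, since strictness of the inequality on the
  feasible set leaves room for an approximate certificate. If the separating functional ignores
  the objective (\<open>l = 0\<close>), it certifies infeasibility and a large multiple of it dominates the
  objective on the compact set.\<close>

lemma conic_certificate:
  fixes L :: "'a::euclidean_space \<Rightarrow> 'b::euclidean_space"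
  assumes L: "linear L" and B: "compact B" "convex B" "B \<noteq> {}" and C: "closed_convex_cone C"
    and strict: "\<And>w. w \<in> B \<Longrightarrow> L w - b \<in> C \<Longrightarrow> \<tau> < a \<bullet> w"
  obtains m where "m \<in> dual_cone C" "\<And>w. w \<in> B \<Longrightarrow> \<tau> + m \<bullet> (L w - b) \<le> a \<bullet> w"
proof -
  \<comment> \<open>Pairs of objective value and constraint slack over \<open>B\<close>. Strictness
    says that this compact convex set misses the closed convex set
    \<open>{..\<tau>} \<times> C\<close>.\<close>
  define S where "S = (\<lambda>z. (0, - b) + z) ` (\<lambda>w. (a \<bullet> w, L w)) ` B"
  have lin: "linear (\<lambda>w. (a \<bullet> w, L w))"
    using L by (auto intro!: linearI simp: linear_add linear_scale inner_add_right)
  have "convex S"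
    unfolding S_def by (intro convex_translation convex_linear_image lin B)
  moreover have "compact S"
    unfolding S_def
    by (intro compact_translation compact_continuous_image B linear_continuous_on)
      (use lin linear_conv_bounded_linear in blast)
  moreover have "S \<noteq> {}" using B by (simp add: S_def)
  moreover have "convex ({..\<tau>} \<times> C)" "closed ({..\<tau>} \<times> C)"
    using C by (auto simp: closed_convex_cone_def intro: convex_Times closed_Times)
  moreover have "S \<inter> ({..\<tau>} \<times> C) = {}"
    using strict by (force simp: S_def)
  ultimately have "\<exists>n \<beta>. (\<forall>x\<in>S. n \<bullet> x < \<beta>) \<and> (\<forall>x\<in>{..\<tau>} \<times> C. n \<bullet> x > \<beta>)"
    by (intro separating_hyperplane_compact_closed)
  then obtain n \<beta> where n: "\<forall>x\<in>S. n \<bullet> x < \<beta>" "\<forall>x\<in>{..\<tau>} \<times> C. n \<bullet> x > \<beta>" by blast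
  \<comment> \<open>The sign is chosen so that \<open>l\<close> becomes the nonnegative weight of
    the objective.\<close>
  obtain l m where lm: "n = (- l, m)" by (metis surj_pair minus_minus)
  have sep1: "m \<bullet> (L w - b) - l * (a \<bullet> w) < \<beta>" if "w \<in> B" for w
    using n(1) that by (force simp: S_def lm)
  have sep2: "\<beta> < m \<bullet> k - l * s" if "s \<le> \<tau>" "k \<in> C" for s k
    using n(2) that by (force simp: lm)
  have C0: "0 \<in> C" and Cs: "\<And>k c. k \<in> C \<Longrightarrow> 0 \<le> c \<Longrightarrow> c *\<^sub>R k \<in> C"
    using C by (auto simp: closed_convex_cone_def)
  have \<beta>: "\<beta> < - l * \<tau>" using sep2[OF order_refl C0] by simp
  \<comment> \<open>For negative \<open>l\<close>, lowering the first coordinate \<open>s\<close>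
    would push \<open>- l * s\<close> down to \<beta>; \<open>- (\<beta> / l)\<close> is where
    equality is reached.\<close>
  have l: "0 \<le> l"
  proof (rule ccontr)
    assume "\<not> 0 \<le> l"
    then have "\<beta> < - l * min \<tau> (- (\<beta> / l))" "- l > 0"
      using sep2[OF _ C0, of "min \<tau> (- (\<beta> / l))"] by auto
    moreover have "- l * min \<tau> (- (\<beta> / l)) \<le> - l * (- (\<beta> / l))"
      using \<open>\<not> 0 \<le> l\<close> by (intro mult_left_mono) auto
    ultimately show False by simp
  qed
  have m: "m \<in> dual_cone C"
  proof (rule ccontr)
    assume "m \<notin> dual_cone C"
    then obtain k where k: "k \<in> C" "m \<bullet> k < 0" by (force simp: dual_cone_def)
    \<comment> \<open>Far enough along the ray through \<open>k\<close> the separating functional is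
      at most \<beta>; the \<open>max\<close> keeps the multiple inside the cone.\<close>
    define c where "c = max 0 ((\<beta> + l * \<tau>) / (m \<bullet> k))"
    have "\<beta> < m \<bullet> (c *\<^sub>R k) - l * \<tau>"
      using k by (intro sep2 Cs) (auto simp: c_def)
    moreover have "c * (m \<bullet> k) \<le> (\<beta> + l * \<tau>) / (m \<bullet> k) * (m \<bullet> k)"
      using k by (intro mult_right_mono_neg) (auto simp: c_def)
    ultimately show False using k by simp
  qed
  show thesis
  proof (cases "l = 0")
    case False
    with l have l: "0 < l" by simp
    show thesis
    proof (rule that)
      show "(1 / l) *\<^sub>R m \<in> dual_cone C" using m l by (intro dual_cone_scaleR) auto
    next
      fix w assume "w \<in> B"
      then have "l * \<tau> + m \<bullet> (L w - b) \<le> l * (a \<bullet> w)" using sep1[of w] \<beta> by simp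
      then show "\<tau> + (1 / l) *\<^sub>R m \<bullet> (L w - b) \<le> a \<bullet> w" using l by (simp add: field_simps)
    qed
  next
    case True
    have "compact ((\<lambda>w. a \<bullet> w) ` B)"
      by (intro compact_continuous_image B continuous_intros)
    then have "bdd_below ((\<lambda>w. a \<bullet> w) ` B)"
      by (intro bounded_imp_bdd_below compact_imp_bounded)
    then obtain c where c: "\<And>w. w \<in> B \<Longrightarrow> c \<le> a \<bullet> w" by (auto simp: bdd_below_def)
    \<comment> \<open>On \<open>B\<close> the functional given by \<open>m\<close> is below \<beta>,
      which is negative here, so the factor \<open>N\<close> brings it down to at most
      \<open>c - \<tau>\<close>.\<close>
    define N where "N = max 0 ((c - \<tau>) / \<beta>)"
    have \<beta>0: "\<beta> < 0" using \<beta> True by simp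
    show thesis
    proof (rule that)
      show "N *\<^sub>R m \<in> dual_cone C" using m by (intro dual_cone_scaleR) (auto simp: N_def)
    next
      fix w assume w: "w \<in> B"
      have "N * (m \<bullet> (L w - b)) \<le> N * \<beta>"
        using sep1[OF w] True by (intro mult_left_mono) (auto simp: N_def)
      also have "\<dots> \<le> (c - \<tau>) / \<beta> * \<beta>"
        using \<beta>0 by (intro mult_right_mono_neg) (auto simp: N_def)
      also have "\<dots> = c - \<tau>" using \<beta>0 by simp
      finally show "\<tau> + N *\<^sub>R m \<bullet> (L w - b) \<le> a \<bullet> w" using c[OF w] by simp
    qed
  qed
qed

subsection \<open>Multipliers for one term of the disjunction\<close>

lemma transpose_mult_eq_sum_rows:
  fixes A :: "real^'n^'m"
  shows "transpose A *v w = (\<Sum>i\<in>UNIV. w $ i *\<^sub>R A $ i)"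
  by (simp add: vec_eq_iff matrix_vector_mult_def transpose_def sum_component mult.commute)

lemma transpose_mult_inner:
  fixes A :: "real^'n^'m"
  shows "(transpose A *v w) \<bullet> x = w \<bullet> (A *v x)"
  by (simp add: dot_lmul_matrix)

section \<open>Sums over the rows of the system describing P\<close>

lemma rows_P_sys:
  "rows (P_sys I cs) = range LeaderRow \<union> range FollowerRow \<union> range YRow \<union> range XLower \<union>
     range XUpper \<union> range YLower \<union> range YUpper \<union> CutRow ` {..<length cs}"
  by (auto simp: P_sys_def image_iff split: row_ix.splits)

lemma finite_rows_P_sys: "finite (rows (P_sys I cs))"
  by (simp add: rows_P_sys)

text \<open>The cut rows are isolated in the last sum. Multipliers that vanish there therefore give
  combinations and norms that do not depend on the list of cuts.\<close>

lemma sum_rows_P_sys: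
  fixes F :: "('n1::finite,'n2::finite,'m1::finite,'m2::finite,'m3::finite) row_ix \<Rightarrow> 'b::comm_monoid_add"
    and I :: "('n1,'n2,'n3::finite,'m1,'m2,'m3,'k::finite) ibnp"
  shows "sum F (rows (P_sys I cs)) =
     (\<Sum>i\<in>UNIV. F (LeaderRow i)) + (\<Sum>i\<in>UNIV. F (FollowerRow i)) + (\<Sum>i\<in>UNIV. F (YRow i)) +
     (\<Sum>i\<in>UNIV. F (XLower i)) + (\<Sum>i\<in>UNIV. F (XUpper i)) + (\<Sum>i\<in>UNIV. F (YLower i)) +
     (\<Sum>i\<in>UNIV. F (YUpper i)) + (\<Sum>k<length cs. F (CutRow k))"
proof -
  have inj: "inj LeaderRow" "inj FollowerRow" "inj YRow" "inj XLower" "inj XUpper" "inj YLower"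
    "inj YUpper" "inj_on CutRow {..<length cs}"
    by (auto intro: injI inj_onI)
  show ?thesis
    unfolding rows_P_sys inj[THEN sum.reindex, unfolded comp_def, symmetric]
    by (subst sum.union_disjoint; (auto; fail)?)+
qed

text \<open>The variable bounds form the compact set over which \<open>conic_certificate\<close> is
  applied; only the remaining constraints go into the cone.\<close>

definition unit_box :: "((real^'n1) \<times> (real^'n2)) set" where
  "unit_box = {(x, y). (\<forall>j. 0 \<le> x $ j \<and> x $ j \<le> 1) \<and> (\<forall>j. 0 \<le> y $ j \<and> y $ j \<le> 1)}"

lemma unit_box_eq_Times: "unit_box = cbox 0 1 \<times> cbox 0 1"
  by (auto simp: unit_box_def mem_box_cart)

lemma compact_unit_box: "compact unit_box"
  unfolding unit_box_eq_Times by (intro compact_Times compact_cbox)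

lemma convex_unit_box: "convex unit_box"
  unfolding unit_box_eq_Times by (intro convex_Times convex_box)

lemma unit_box_nonempty: "unit_box \<noteq> {}"
proof -
  have "(0, 0) \<in> unit_box" by (simp add: unit_box_def)
  then show ?thesis by blast
qed

text \<open>A linear form attains its minimum over the box at the vertex with ones exactly at the
  negative coefficients.\<close>

lemma le_minus_neg_parts:
  fixes a :: "real^'n1" and b :: "real^'n2"
  assumes "\<And>x y. (x, y) \<in> unit_box \<Longrightarrow> \<tau> \<le> a \<bullet> x + b \<bullet> y + c"
  shows "\<tau> \<le> c - (\<Sum>j\<in>UNIV. max 0 (- (a $ j))) - (\<Sum>j\<in>UNIV. max 0 (- (b $ j)))"
proof -
  let ?x = "(\<chi> j. if a $ j < 0 then 1 else 0) :: real^'n1"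
  let ?y = "(\<chi> j. if b $ j < 0 then 1 else 0) :: real^'n2"
  have "a \<bullet> ?x = - (\<Sum>j\<in>UNIV. max 0 (- (a $ j)))" "b \<bullet> ?y = - (\<Sum>j\<in>UNIV. max 0 (- (b $ j)))"
    by (auto simp: inner_vec_def sum_negf[symmetric] max_def intro!: sum.cong)
  moreover have "\<tau> \<le> a \<bullet> ?x + b \<bullet> ?y + c"
    by (rule assms) (simp add: unit_box_def)
  ultimately show ?thesis by simp
qed

text \<open>Any coefficient vector is a nonnegative combination of bound rows: positive parts weight
  the lower bounds and negative parts the upper bounds.\<close>

lemma sum_parts_axis:
  "(\<Sum>j\<in>UNIV. max 0 (a $ j) *\<^sub>R axis j (1::real)) + (\<Sum>j\<in>UNIV. max 0 (- (a $ j)) *\<^sub>R - axis j 1) = a"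
proof -
  have "(\<Sum>j\<in>UNIV. max 0 (a $ j) *\<^sub>R axis j (1::real)) + (\<Sum>j\<in>UNIV. max 0 (- (a $ j)) *\<^sub>R - axis j 1)
      = (\<Sum>j\<in>UNIV. a $ j *\<^sub>R axis j 1)"
    unfolding sum.distrib[symmetric]
    by (intro sum.cong) (auto simp: max_def)
  also have "\<dots> = a"
    by (simp add: basis_expansion scalar_mult_eq_scaleR[symmetric])
  finally show ?thesis .
qed

text \<open>The abstract constraint \<open>Lx x + Ly y - b \<in> D\<close> stands for one term of the disjunction;
  \<open>Lx'\<close> and \<open>Ly'\<close> are the adjoints.\<close>

lemma term_multipliers:
  fixes I :: "('n1::finite,'n2::finite,'n3::finite,'m1::finite,'m2::finite,'m3::finite,'k::finite) ibnp"
    and D :: "'d::euclidean_space set"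
  assumes K: "closed_convex_cone (K_con I)" and D: "closed_convex_cone D"
    and L: "linear L" and adj: "\<And>d x y. d \<bullet> L (x, y) = Lx' d \<bullet> x + Ly' d \<bullet> y"
    and strict: "\<And>x y. (x, y) \<in> hpr_cont_feasible I \<Longrightarrow> L (x, y) - b \<in> D \<Longrightarrow> \<tau> < \<alpha> \<bullet> x + \<beta> \<bullet> y"
  obtains pb :: "('n1,'n2,'m1,'m2,'m3) row_ix \<Rightarrow> real" and pt d where
    "\<And>r. 0 \<le> pb r" "pt \<in> dual_cone (K_con I)" "d \<in> dual_cone D" "\<And>k. pb (CutRow k) = 0"
    "\<And>cs. \<alpha> = (\<Sum>r\<in>rows (P_sys I cs). pb r *\<^sub>R Mbar (P_sys I cs) r) + transpose (M_con I) *v pt + Lx' d"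
    "\<And>cs. \<beta> = (\<Sum>r\<in>rows (P_sys I cs). pb r *\<^sub>R Nbar (P_sys I cs) r) + transpose (N_con I) *v pt + Ly' d"
    "\<And>cs. \<tau> \<le> (\<Sum>r\<in>rows (P_sys I cs). pb r * hbar (P_sys I cs) r) + pt \<bullet> h_con I + d \<bullet> b"
proof -
  let ?P1 = "{z :: real^'m1. 0 \<le> z}" and ?P2 = "{z :: real^'m2. 0 \<le> z}"
    and ?P3 = "{z :: real^'m3. 0 \<le> z}"
  define C where "C = ?P1 \<times> ?P2 \<times> ?P3 \<times> K_con I \<times> D"
  define \<Phi> where "\<Phi> w = (M_lead I *v fst w + N_lead I *v snd w, A_real I *v fst w + B_real I *v snd w,
    T_Y I *v snd w, M_con I *v fst w + N_con I *v snd w, L w)" for w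
  define bb where "bb = (h_lead I, f_real I, t_Y I, h_con I, b)"
  have "linear \<Phi>"
    unfolding \<Phi>_def
    by (rule linearI) (simp_all add: linear_add[OF L] linear_scale[OF L]
        matrix_vector_right_distrib matrix_vector_mult_scaleR scaleR_add_right)
  moreover have "closed_convex_cone C"
    unfolding C_def by (intro closed_convex_cone_Times closed_convex_cone_nonneg_vec K D)
  moreover have "\<tau> < (\<alpha>, \<beta>) \<bullet> w" if "w \<in> unit_box" "\<Phi> w - bb \<in> C" for w
    using that strict[of "fst w" "snd w"]
    by (cases w) (auto simp: \<Phi>_def bb_def C_def hpr_cont_feasible_def leader_constraints_def
        poly_Y_def unit_box_def)
  ultimately obtain m where m: "m \<in> dual_cone C"
    and mle: "\<And>w. w \<in> unit_box \<Longrightarrow> \<tau> + m \<bullet> (\<Phi> w - bb) \<le> (\<alpha>, \<beta>) \<bullet> w"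
    using conic_certificate[OF _ compact_unit_box convex_unit_box unit_box_nonempty] by metis
  obtain m1 m2 m3 pt d where m_eq: "m = (m1, m2, m3, pt, d)" by (metis surj_pair)
  have zero: "0 \<in> K_con I" "0 \<in> D" using K D by (auto simp: closed_convex_cone_def)
  have "dual_cone C = ?P1 \<times> ?P2 \<times> ?P3 \<times> dual_cone (K_con I) \<times> dual_cone D"
    unfolding C_def using zero by (simp add: dual_cone_Times dual_cone_nonneg_vec zero_prod_def)
  with m have nonneg: "\<And>i. 0 \<le> m1 $ i" "\<And>i. 0 \<le> m2 $ i" "\<And>i. 0 \<le> m3 $ i"
    and pt: "pt \<in> dual_cone (K_con I)" and d: "d \<in> dual_cone D"
    by (auto simp: m_eq less_eq_vec_def)
  \<comment> \<open>\<open>(a, e)\<close> is the part of \<open>(\<alpha>, \<beta>)\<close> that the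
    multipliers from the cone do not account for. It will be charged to the bound rows.\<close>
  define a where "a = \<alpha> - (transpose (M_lead I) *v m1 + transpose (A_real I) *v m2 +
    transpose (M_con I) *v pt + Lx' d)"
  define e where "e = \<beta> - (transpose (N_lead I) *v m1 + transpose (B_real I) *v m2 +
    transpose (T_Y I) *v m3 + transpose (N_con I) *v pt + Ly' d)"
  have "\<tau> \<le> a \<bullet> x + e \<bullet> y + m \<bullet> bb" if "(x, y) \<in> unit_box" for x y
  proof -
    have "\<tau> + m \<bullet> (\<Phi> (x, y) - bb) \<le> \<alpha> \<bullet> x + \<beta> \<bullet> y"
      using mle[OF that] by simp
    moreover have "m \<bullet> \<Phi> (x, y) = (\<alpha> - a) \<bullet> x + (\<beta> - e) \<bullet> y"
      unfolding a_def e_def \<Phi>_def m_eq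
      by (simp add: inner_add_left inner_add_right transpose_mult_inner adj del: transpose_matrix_vector)
    ultimately show ?thesis by (simp add: inner_diff_left inner_diff_right)
  qed
  then have \<tau>: "\<tau> \<le> m \<bullet> bb - (\<Sum>j\<in>UNIV. max 0 (- (a $ j))) - (\<Sum>j\<in>UNIV. max 0 (- (e $ j)))"
    by (rule le_minus_neg_parts)
  \<comment> \<open>Positive and negative parts of \<open>a\<close> and \<open>e\<close> become the
    multipliers of the lower and upper bounds; the certificate has no component for the cuts, so
    their rows get 0.\<close>
  define pb :: "('n1,'n2,'m1,'m2,'m3) row_ix \<Rightarrow> real" where
    "pb r = (case r of LeaderRow i \<Rightarrow> m1 $ i | FollowerRow i \<Rightarrow> m2 $ i | YRow i \<Rightarrow> m3 $ i
       | XLower j \<Rightarrow> max 0 (a $ j) | XUpper j \<Rightarrow> max 0 (- (a $ j))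
       | YLower j \<Rightarrow> max 0 (e $ j) | YUpper j \<Rightarrow> max 0 (- (e $ j)) | CutRow k \<Rightarrow> 0)" for r
  show thesis
  proof (rule that[OF _ pt d])
    show "0 \<le> pb r" for r by (auto simp: pb_def nonneg split: row_ix.split)
    show "pb (CutRow k) = 0" for k by (simp add: pb_def)
  next
    fix cs
    have "(\<Sum>r\<in>rows (P_sys I cs). pb r *\<^sub>R Mbar (P_sys I cs) r) =
        transpose (M_lead I) *v m1 + transpose (A_real I) *v m2 + a"
      unfolding sum_rows_P_sys
      by (subst sum_parts_axis[of a, symmetric])
        (simp add: pb_def P_sys_def transpose_mult_eq_sum_rows del: transpose_matrix_vector)
    then show "\<alpha> = (\<Sum>r\<in>rows (P_sys I cs). pb r *\<^sub>R Mbar (P_sys I cs) r) + transpose (M_con I) *v pt + Lx' d"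
      by (simp add: a_def del: transpose_matrix_vector)
    have "(\<Sum>r\<in>rows (P_sys I cs). pb r *\<^sub>R Nbar (P_sys I cs) r) =
        transpose (N_lead I) *v m1 + transpose (B_real I) *v m2 + transpose (T_Y I) *v m3 + e"
      unfolding sum_rows_P_sys
      by (subst sum_parts_axis[of e, symmetric])
        (simp add: pb_def P_sys_def transpose_mult_eq_sum_rows del: transpose_matrix_vector)
    then show "\<beta> = (\<Sum>r\<in>rows (P_sys I cs). pb r *\<^sub>R Nbar (P_sys I cs) r) + transpose (N_con I) *v pt + Ly' d"
      by (simp add: e_def del: transpose_matrix_vector)
    \<comment> \<open>Among the bound rows only the upper bounds have a nonzero right-hand side,
      namely -1. Their contribution is exactly the box minimum subtracted in
      \<open>\<tau>\<close>.\<close>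
    have "(\<Sum>r\<in>rows (P_sys I cs). pb r * hbar (P_sys I cs) r) = m1 \<bullet> h_lead I + m2 \<bullet> f_real I +
        m3 \<bullet> t_Y I - (\<Sum>j\<in>UNIV. max 0 (- (a $ j))) - (\<Sum>j\<in>UNIV. max 0 (- (e $ j)))"
      unfolding sum_rows_P_sys by (simp add: pb_def P_sys_def inner_vec_def sum_negf)
    with \<tau> show "\<tau> \<le> (\<Sum>r\<in>rows (P_sys I cs). pb r * hbar (P_sys I cs) r) + pt \<bullet> h_con I + d \<bullet> b"
      by (simp add: m_eq bb_def)
  qed
qed

subsection \<open>Validity of the cuts\<close>

lemma continuous_on_matrix_vector_mult [continuous_intros]:
  fixes A :: "real^'n^'m"
  assumes "continuous_on S f"
  shows "continuous_on S (\<lambda>x. A *v f x)"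
proof -
  have "bounded_linear ((*v) A)"
    by (simp add: matrix_vector_mul_bounded_linear)
  then show ?thesis
    using assms by (rule bounded_linear.continuous_on)
qed

text \<open>One expression per disjunct, with \<open>None\<close> for term 0. The equations of the
  cut generating problem then say that its value is the same for all \<open>t\<close>; likewise for
  \<open>mult_beta\<close>.\<close>

definition mult_alpha where
  "mult_alpha I S m t = (\<Sum>r\<in>rows S. pbar m t r *\<^sub>R Mbar S r) + transpose (M_con I) *v ptil m t +
     (case t of None \<Rightarrow> 0 | Some i \<Rightarrow> sig m $ i *\<^sub>R A_real I $ i)"

definition mult_beta where
  "mult_beta I S m t = (\<Sum>r\<in>rows S. pbar m t r *\<^sub>R Nbar S r) + transpose (N_con I) *v ptil m t +
     (case t of None \<Rightarrow> Dtil_transpose I (rho m) | Some i \<Rightarrow> 0)"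

definition mult_tau where
  "mult_tau I S yh m t = (\<Sum>r\<in>rows S. pbar m t r * hbar S r) + ptil m t \<bullet> h_con I +
     (case t of None \<Rightarrow> rho m \<bullet> ctil I yh | Some i \<Rightarrow> sig m $ i * disj_rhs I yh i)"

definition mult_signs where
  "mult_signs I S m \<longleftrightarrow> (\<forall>i. sig m $ i \<le> 0) \<and> rho m \<in> dual_cone soc_Q \<and>
     (\<forall>t. \<forall>r\<in>rows S. 0 \<le> pbar m t r) \<and> (\<forall>t. ptil m t \<in> dual_cone (K_con I))"

lemma cg_feasible_iff:
  "cg_feasible I S p yh (\<alpha>, \<beta>, \<tau>) m \<longleftrightarrow>
     (\<forall>t. \<alpha> = mult_alpha I S m t) \<and> (\<forall>t. \<beta> = mult_beta I S m t) \<and> (\<forall>t. \<tau> \<le> mult_tau I S yh m t) \<and>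
     mult_signs I S m \<and> mult_norm p (rows S) m \<le> 1"
  unfolding cg_feasible_def mult_signs_def split_option_all
  by (auto simp: mult_alpha_def mult_beta_def mult_tau_def simp del: transpose_matrix_vector)

text \<open>Weak duality inside one disjunct: every multiplier pairs nonnegatively with the slack of
  its constraint. The nonpositive \<open>sig\<close> matches the direction of the inequality in
  terms \<open>Some i\<close>, and \<open>rho\<close> pairs with a slack in \<open>soc_Q\<close> in
  term 0.\<close>

lemma mult_tau_le:
  assumes m: "mult_signs I S m" and w: "(x, y) \<in> sys_set I S" and t: "disj_term I yh t (x, y)"
  shows "mult_tau I S yh m t \<le> mult_alpha I S m t \<bullet> x + mult_beta I S m t \<bullet> y"
proof -
  let ?lin = "(\<Sum>r\<in>rows S. pbar m t r *\<^sub>R Mbar S r) \<bullet> x + (\<Sum>r\<in>rows S. pbar m t r *\<^sub>R Nbar S r) \<bullet> y"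
  have "(\<Sum>r\<in>rows S. pbar m t r * hbar S r) \<le>
      (\<Sum>r\<in>rows S. pbar m t r * (Mbar S r \<bullet> x + Nbar S r \<bullet> y))"
    using m w by (intro sum_mono mult_left_mono) (auto simp: mult_signs_def sys_set_def)
  also have "\<dots> = ?lin"
    by (simp add: inner_sum_left sum.distrib[symmetric] algebra_simps)
  finally have 1: "(\<Sum>r\<in>rows S. pbar m t r * hbar S r) \<le> ?lin" .
  have "0 \<le> ptil m t \<bullet> (M_con I *v x + N_con I *v y - h_con I)"
    using m w by (auto simp: mult_signs_def sys_set_def dual_cone_def)
  then have 2: "ptil m t \<bullet> h_con I \<le>
      (transpose (M_con I) *v ptil m t) \<bullet> x + (transpose (N_con I) *v ptil m t) \<bullet> y"
    by (simp add: transpose_mult_inner inner_add_right inner_diff_right del: transpose_matrix_vector)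
  show ?thesis
  proof (cases t)
    case None
    have "0 \<le> rho m \<bullet> (Dtil I y - ctil I yh)"
      using m t by (auto simp: mult_signs_def dual_cone_def disj_term_def None Dtil_in_soc_Q_iff)
    then show ?thesis
      using 1 2 by (simp add: mult_tau_def mult_alpha_def mult_beta_def None inner_add_left
          inner_diff_right inner_Dtil del: transpose_matrix_vector)
  next
    case (Some i)
    have "sig m $ i * disj_rhs I yh i \<le> sig m $ i * (A_real I $ i \<bullet> x)"
      using m t by (auto simp: mult_signs_def disj_term_def Some intro: mult_left_mono_neg)
    then show ?thesis
      using 1 2 by (simp add: mult_tau_def mult_alpha_def mult_beta_def Some inner_add_left
          del: transpose_matrix_vector)
  qed
qed

lemma cg_feasible_valid:
  assumes "cg_feasible I S p yh c m" and "w \<in> sys_set I S" and "disj_term I yh t w"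
  shows "satisfies_cut w c"
proof -
  obtain \<alpha> \<beta> \<tau> where c: "c = (\<alpha>, \<beta>, \<tau>)" by (metis surj_pair)
  obtain x y where w: "w = (x, y)" by (metis surj_pair)
  have "\<tau> \<le> mult_tau I S yh m t" "mult_alpha I S m t = \<alpha>" "mult_beta I S m t = \<beta>" "mult_signs I S m"
    using assms(1) unfolding c cg_feasible_iff by auto
  then show ?thesis
    using mult_tau_le[of I S m x y yh t] assms(2,3) by (simp add: satisfies_cut_def c w)
qed

lemma convex_satisfies_cut: "convex {w. satisfies_cut w c}"
proof -
  obtain \<alpha> \<beta> \<tau> where c: "c = (\<alpha>, \<beta>, \<tau>)" by (metis surj_pair)
  have "{w. satisfies_cut w c} = {w. \<tau> \<le> (\<alpha>, \<beta>) \<bullet> w}"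
    by (auto simp: satisfies_cut_def c)
  then show ?thesis
    using convex_halfspace_ge[of \<tau> "(\<alpha>, \<beta>)"] by simp
qed

text \<open>The half-space of the cut is convex and contains every disjunct, hence also their
  hull.\<close>

lemma cg_feasible_valid_hull:
  assumes "cg_feasible I S p yh c m" and "w \<in> disj_hull I yh (sys_set I S)"
  shows "satisfies_cut w c"
proof -
  have "disj_hull I yh (sys_set I S) \<subseteq> {w. satisfies_cut w c}"
    unfolding disj_hull_def
    using cg_feasible_valid[OF assms(1)] by (intro hull_minimal convex_satisfies_cut) auto
  then show ?thesis using assms(2) by blast
qed

subsection \<open>Optimal solutions of the cut generating problem\<close>

text \<open>The normalization expression before the root is taken: it defines the same unit ball and
  is easier to scale.\<close>

definition mult_power where
  "mult_power p X m =
     (\<Sum>t\<in>UNIV. \<Sum>r\<in>X. \<bar>pbar m t r\<bar> ^ p) + (\<Sum>t\<in>UNIV. \<Sum>k\<in>UNIV. \<bar>ptil m t $ k\<bar> ^ p)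
      + (\<Sum>i\<in>UNIV. \<bar>sig m $ i\<bar> ^ p)
      + (\<bar>fst (rho m)\<bar> ^ p + (\<Sum>l\<in>UNIV. \<bar>fst (snd (rho m)) $ l\<bar> ^ p) + \<bar>snd (snd (rho m))\<bar> ^ p)"

lemma mult_norm_le_1_iff:
  assumes "p \<in> {1, 2}"
  shows "mult_norm p X m \<le> 1 \<longleftrightarrow> mult_power p X m \<le> 1"
proof -
  have "0 < p" using assms by auto
  then show ?thesis
    by (simp add: mult_norm_def mult_power_def case_prod_beta real_root_le_1_iff)
qed

text \<open>A sum of nonnegative terms bounded by 1 bounds each term. The entrywise bounds confine
  feasible multipliers to a compact box.\<close>

lemma mult_power_le_1_D:
  fixes m :: "('i, 'n3::finite, 'm2::finite, 'k::finite) mult"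
  assumes X: "finite X" and p: "p \<in> {1, 2::nat}" and le: "mult_power p X m \<le> 1"
  shows "r \<in> X \<Longrightarrow> \<bar>pbar m t r\<bar> \<le> 1" "\<bar>ptil m t $ k\<bar> \<le> 1" "\<bar>sig m $ i\<bar> \<le> 1"
    "\<bar>fst (rho m)\<bar> \<le> 1" "\<bar>fst (snd (rho m)) $ l\<bar> \<le> 1" "\<bar>snd (snd (rho m))\<bar> \<le> 1"
proof -
  have pow: "\<bar>a\<bar> \<le> 1" if "\<bar>a\<bar> ^ p \<le> 1" for a :: real
    using that p power_le_one_iff[of "\<bar>a\<bar>" p] by auto
  let ?a = "\<Sum>t\<in>UNIV. \<Sum>r\<in>X. \<bar>pbar m t r\<bar> ^ p" and ?b = "\<Sum>t\<in>UNIV. \<Sum>k\<in>UNIV. \<bar>ptil m t $ k\<bar> ^ p"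
    and ?c = "\<Sum>i\<in>UNIV. \<bar>sig m $ i\<bar> ^ p" and ?d = "\<Sum>l\<in>UNIV. \<bar>fst (snd (rho m)) $ l\<bar> ^ p"
  have nn: "0 \<le> ?a" "0 \<le> ?b" "0 \<le> ?c" "0 \<le> ?d" "0 \<le> \<bar>fst (rho m)\<bar> ^ p" "0 \<le> \<bar>snd (snd (rho m))\<bar> ^ p"
    by (auto intro!: sum_nonneg)
  have le1: "?a \<le> 1" "?b \<le> 1" "?c \<le> 1" "?d \<le> 1" "\<bar>fst (rho m)\<bar> ^ p \<le> 1" "\<bar>snd (snd (rho m))\<bar> ^ p \<le> 1"
    using le nn unfolding mult_power_def by linarith+
  show "\<bar>fst (rho m)\<bar> \<le> 1" "\<bar>snd (snd (rho m))\<bar> \<le> 1"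
    using le1 by (auto intro: pow)
  show "\<bar>sig m $ i\<bar> \<le> 1"
    using member_le_sum[of i UNIV "\<lambda>i. \<bar>sig m $ i\<bar> ^ p"] le1 by (intro pow) auto
  show "\<bar>fst (snd (rho m)) $ l\<bar> \<le> 1"
    using member_le_sum[of l UNIV "\<lambda>l. \<bar>fst (snd (rho m)) $ l\<bar> ^ p"] le1 by (intro pow) auto
  have "\<bar>ptil m t $ k\<bar> ^ p \<le> (\<Sum>k\<in>UNIV. \<bar>ptil m t $ k\<bar> ^ p)"
    by (rule member_le_sum) auto
  also have "\<dots> \<le> ?b"
    by (rule member_le_sum) (auto intro: sum_nonneg)
  finally show "\<bar>ptil m t $ k\<bar> \<le> 1" using le1 by (intro pow) auto
  assume "r \<in> X"
  then have "\<bar>pbar m t r\<bar> ^ p \<le> (\<Sum>r\<in>X. \<bar>pbar m t r\<bar> ^ p)"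
    using X by (intro member_le_sum) auto
  also have "\<dots> \<le> ?a"
    by (rule member_le_sum) (auto intro: sum_nonneg)
  finally show "\<bar>pbar m t r\<bar> \<le> 1" using le1 by (intro pow) auto
qed

text \<open>Tychonoff's theorem. It applies to \<open>pbar\<close>, which is a function on a row
  index type that may be infinite.\<close>

lemma compact_product_UNIV:
  assumes "\<And>i. compact (S i)"
  shows "compact {h. \<forall>i. h i \<in> S i}"
proof -
  have "compactin (product_topology (\<lambda>i. euclidean) UNIV) (PiE UNIV S)"
    using assms by (simp add: compactin_PiE)
  moreover have "PiE UNIV S = {h. \<forall>i. h i \<in> S i}" by auto
  ultimately show ?thesis by (simp add: euclidean_product_topology)
qed

lemma continuous_on_Min_image:
  fixes f :: "'a::finite \<Rightarrow> 'b::topological_space \<Rightarrow> real"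
  assumes "\<And>t. continuous_on S (f t)"
  shows "continuous_on S (\<lambda>x. Min (range (\<lambda>t. f t x)))"
proof -
  have "continuous_on S (\<lambda>x. Min ((\<lambda>t. f t x) ` A))" if "finite A" "A \<noteq> {}" for A
    using that by (induction A rule: finite_ne_induct) (auto intro!: continuous_on_min assms)
  then show ?thesis by simp
qed

text \<open>A product type carries the topology needed for the compactness argument, which the
  record does not.\<close>

type_synonym ('i, 'n3, 'm2, 'k) mult_tuple =
  "('m2 option \<Rightarrow> 'i \<Rightarrow> real) \<times> ('m2 option \<Rightarrow> real^'k) \<times> (real^'m2) \<times> (real \<times> (real^'n3) \<times> real)"

definition mult_of :: "('i, 'n3::finite, 'm2::finite, 'k::finite) mult_tuple \<Rightarrow> ('i, 'n3, 'm2, 'k) mult" where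
  "mult_of q = \<lparr>pbar = fst q, ptil = fst (snd q), sig = fst (snd (snd q)), rho = snd (snd (snd q))\<rparr>"

lemma mult_of_sel [simp]:
  "pbar (mult_of q) = fst q" "ptil (mult_of q) = fst (snd q)" "sig (mult_of q) = fst (snd (snd q))"
  "rho (mult_of q) = snd (snd (snd q))"
  by (simp_all add: mult_of_def)

text \<open>The instances needed of continuous_on_product_then_coordinatewise, which makes
  higher-order unification diverge when it is used as an introduction rule.\<close>

lemma continuous_on_mult_tuple [continuous_intros]:
  "continuous_on A (\<lambda>q :: ('i, 'n3::finite, 'm2::finite, 'k::finite) mult_tuple. fst q t r)"
  "continuous_on A (\<lambda>q :: ('i, 'n3, 'm2, 'k) mult_tuple. fst (snd q) t)"
proof -
  have "continuous_on A (\<lambda>q :: ('i, 'n3, 'm2, 'k) mult_tuple. fst q)"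
    by (intro continuous_intros)
  then show "continuous_on A (\<lambda>q :: ('i, 'n3, 'm2, 'k) mult_tuple. fst q t r)"
    by (rule continuous_on_product_then_coordinatewise[OF
          continuous_on_product_then_coordinatewise])
  have "continuous_on A (\<lambda>q :: ('i, 'n3, 'm2, 'k) mult_tuple. fst (snd q))"
    by (intro continuous_intros)
  then show "continuous_on A (\<lambda>q :: ('i, 'n3, 'm2, 'k) mult_tuple. fst (snd q) t)"
    by (rule continuous_on_product_then_coordinatewise)
qed

lemma continuous_on_mult_of:
  fixes I :: "('n1::finite,'n2::finite,'n3::finite,'m1::finite,'m2::finite,'m3::finite,'k::finite) ibnp"
    and S :: "('i,'n1,'n2) lin_sys"
  shows "continuous_on UNIV (\<lambda>q. mult_alpha I S (mult_of q) t)"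
    "continuous_on UNIV (\<lambda>q. mult_beta I S (mult_of q) t)"
    "continuous_on UNIV (\<lambda>q. mult_tau I S yh (mult_of q) t)"
    "continuous_on UNIV (\<lambda>q :: ('i,'n3,'m2,'k) mult_tuple. mult_power p X (mult_of q))"
  unfolding mult_alpha_def mult_beta_def mult_tau_def mult_power_def mult_of_sel Dtil_transpose_def
    case_prod_beta
  by ((cases t; simp only: option.case; intro continuous_intros)+, intro continuous_intros)

lemma closed_mult_signs:
  fixes I :: "('n1::finite,'n2::finite,'n3::finite,'m1::finite,'m2::finite,'m3::finite,'k::finite) ibnp"
    and S :: "('i,'n1,'n2) lin_sys"
  shows "closed {q :: ('i,'n3,'m2,'k) mult_tuple. mult_signs I S (mult_of q)}"
proof -
  have "closed ((\<lambda>q :: ('i,'n3,'m2,'k) mult_tuple. snd (snd (snd q))) -` dual_cone soc_Q)"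
    by (intro closed_vimage closed_dual_cone continuous_intros)
  then have 1: "closed {q :: ('i,'n3,'m2,'k) mult_tuple. snd (snd (snd q)) \<in> dual_cone soc_Q}"
    by (simp only: vimage_def)
  have "closed ((\<lambda>q :: ('i,'n3,'m2,'k) mult_tuple. fst (snd q) t) -` dual_cone (K_con I))" for t
    by (intro closed_vimage closed_dual_cone continuous_intros)
  then have 2: "closed {q :: ('i,'n3,'m2,'k) mult_tuple. fst (snd q) t \<in> dual_cone (K_con I)}" for t
    by (simp only: vimage_def)
  show ?thesis
    unfolding mult_signs_def mult_of_sel Ball_def
    by (intro closed_Collect_conj closed_Collect_all closed_Collect_imp open_Collect_const
        closed_Collect_le continuous_intros 1 2)
qed

text \<open>Weierstrass: the multipliers determine \<alpha>, \<beta> and the best \<tau>, so the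
  violation is a continuous function on a nonempty compact set of multipliers.\<close>

lemma ex_cg_optimal:
  fixes I :: "('n1::finite,'n2::finite,'n3::finite,'m1::finite,'m2::finite,'m3::finite,'k::finite) ibnp"
    and S :: "('i,'n1,'n2) lin_sys"
  assumes fin: "finite (rows S)" and p: "p \<in> {1, 2}"
  shows "\<exists>c. cg_optimal I S p yh z c"
proof -
  obtain x y where z: "z = (x, y)" by (metis surj_pair)
  let ?al = "\<lambda>q t. mult_alpha I S (mult_of q) t" and ?be = "\<lambda>q t. mult_beta I S (mult_of q) t"
  \<comment> \<open>The largest \<tau> that all disjuncts allow.\<close>
  let ?tau = "\<lambda>q :: ('i,'n3,'m2,'k) mult_tuple. Min (range (mult_tau I S yh (mult_of q)))"
  define Bx :: "('i,'n3,'m2,'k) mult_tuple set" where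
    "Bx = {h. \<forall>t. h t \<in> {h'. \<forall>r. h' r \<in> {-1..1}}} \<times> {h. \<forall>t. h t \<in> cbox (- 1) 1} \<times> cbox (- 1) 1 \<times>
       ({-1..1} \<times> cbox (- 1) 1 \<times> {-1..1})"
  define F where "F = {q. (\<forall>t. ?al q None = ?al q t) \<and> (\<forall>t. ?be q None = ?be q t) \<and>
    mult_signs I S (mult_of q) \<and> mult_power p (rows S) (mult_of q) \<le> 1}"
  have "closed F"
    unfolding F_def
    by (intro closed_Collect_conj closed_Collect_all closed_Collect_eq closed_Collect_le
        closed_mult_signs continuous_on_mult_of continuous_intros)
  moreover have "compact Bx"
    unfolding Bx_def
    by (intro compact_Times compact_product_UNIV compact_cbox compact_Icc)
  ultimately have "compact (Bx \<inter> F)" by (rule compact_Int_closed[rotated])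
  moreover have "((\<lambda>t r. 0, \<lambda>t. 0, 0, 0)) \<in> Bx \<inter> F"
    using p by (auto simp: Bx_def F_def mult_alpha_def mult_beta_def mult_signs_def mult_power_def
        dual_cone_def Dtil_transpose_def zero_prod_def mem_box_cart split: option.split)
  moreover have "continuous_on (Bx \<inter> F) (\<lambda>q. ?tau q - ?al q None \<bullet> x - ?be q None \<bullet> y)"
    by (rule continuous_on_subset[OF _ subset_UNIV])
      (intro continuous_on_diff continuous_on_inner continuous_on_const continuous_on_Min_image
        continuous_on_mult_of)
  ultimately obtain q where q: "q \<in> Bx \<inter> F" and max: "\<And>q'. q' \<in> Bx \<inter> F \<Longrightarrow>
      ?tau q' - ?al q' None \<bullet> x - ?be q' None \<bullet> y \<le> ?tau q - ?al q None \<bullet> x - ?be q None \<bullet> y"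
    using continuous_attains_sup[of "Bx \<inter> F"] by blast
  let ?c = "(?al q None, ?be q None, ?tau q)"
  have "cg_feasible I S p yh ?c (mult_of q)"
    using q unfolding cg_feasible_iff mult_norm_le_1_iff[OF p] F_def Int_iff mem_Collect_eq
    by (elim conjE, intro conjI allI) (assumption | erule spec | simp)+
  moreover have "cut_violation z c' \<le> cut_violation z ?c" if "cg_feasible I S p yh c' m'" for c' m'
  proof -
    obtain \<alpha> \<beta> \<tau> where c': "c' = (\<alpha>, \<beta>, \<tau>)" by (metis surj_pair)
    \<comment> \<open>Values of \<open>pbar\<close> outside the row set affect neither feasibility
      nor the violation, but they could leave the box \<open>Bx\<close>, so they are set to
      0.\<close>
    define q' :: "('i,'n3,'m2,'k) mult_tuple" where
      "q' = (\<lambda>t r. if r \<in> rows S then pbar m' t r else 0, ptil m', sig m', rho m')"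
    have same: "?al q' t = mult_alpha I S m' t" "?be q' t = mult_beta I S m' t"
      "mult_tau I S yh (mult_of q') t = mult_tau I S yh m' t"
      "mult_signs I S (mult_of q') \<longleftrightarrow> mult_signs I S m'"
      "mult_power p (rows S) (mult_of q') = mult_power p (rows S) m'" for t
      by (simp_all add: q'_def mult_alpha_def mult_beta_def mult_tau_def mult_signs_def mult_power_def
          cong: sum.cong option.case_cong)
    have m': "\<And>t. \<alpha> = mult_alpha I S m' t" "\<And>t. \<beta> = mult_beta I S m' t"
      "\<And>t. \<tau> \<le> mult_tau I S yh m' t" "mult_signs I S m'" "mult_power p (rows S) m' \<le> 1"
      using that[unfolded c' cg_feasible_iff mult_norm_le_1_iff[OF p]] by blast+
    have "q' \<in> F"
      unfolding F_def mem_Collect_eq same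
      by (intro conjI allI m'(4,5) trans[OF m'(1)[symmetric] m'(1)] trans[OF m'(2)[symmetric] m'(2)])
    moreover have "q' \<in> Bx"
      using mult_power_le_1_D[OF fin p m'(5)]
      by (auto simp: q'_def Bx_def mem_box_cart mem_Times_iff abs_le_iff minus_le_iff)
    ultimately have "?tau q' - ?al q' None \<bullet> x - ?be q' None \<bullet> y \<le> ?tau q - ?al q None \<bullet> x - ?be q None \<bullet> y"
      by (intro max) auto
    moreover have "\<tau> \<le> ?tau q'"
      using m'(3) by (auto simp: same)
    ultimately show ?thesis
      unfolding same m'(1,2)[of None, symmetric] z c' cut_violation_def prod.case by linarith
  qed
  ultimately show ?thesis
    unfolding cg_optimal_def by blast
qed

subsection \<open>Violation of a cut at binary points\<close>

definition scale_mult :: "real \<Rightarrow> ('i, 'n3::finite, 'm2::finite, 'k::finite) mult \<Rightarrow> ('i, 'n3, 'm2, 'k) mult" where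
  "scale_mult \<kappa> m = \<lparr>pbar = (\<lambda>t r. \<kappa> * pbar m t r), ptil = (\<lambda>t. \<kappa> *\<^sub>R ptil m t),
     sig = \<kappa> *\<^sub>R sig m, rho = \<kappa> *\<^sub>R rho m\<rparr>"

lemma Dtil_transpose_scaleR: "Dtil_transpose I (\<kappa> *\<^sub>R r) = \<kappa> *\<^sub>R Dtil_transpose I r"
  by (cases r) (simp add: Dtil_transpose_def scaleR_add_right scaleR_diff_right matrix_vector_mult_scaleR
      del: transpose_matrix_vector)

lemma mult_scale:
  "mult_alpha I S (scale_mult \<kappa> m) t = \<kappa> *\<^sub>R mult_alpha I S m t"
  "mult_beta I S (scale_mult \<kappa> m) t = \<kappa> *\<^sub>R mult_beta I S m t"
  "mult_tau I S yh (scale_mult \<kappa> m) t = \<kappa> * mult_tau I S yh m t"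
  "mult_power p X (scale_mult \<kappa> m) = \<bar>\<kappa>\<bar> ^ p * mult_power p X m"
  by (cases t; simp add: scale_mult_def mult_alpha_def mult_beta_def mult_tau_def mult_power_def
      scaleR_add_right scaleR_sum_right matrix_vector_mult_scaleR Dtil_transpose_scaleR sum_distrib_left
      abs_mult power_mult_distrib algebra_simps del: transpose_matrix_vector)+

lemma mult_signs_scale: "mult_signs I S m \<Longrightarrow> 0 \<le> \<kappa> \<Longrightarrow> mult_signs I S (scale_mult \<kappa> m)"
  by (auto simp: scale_mult_def mult_signs_def dual_cone_scaleR mult_nonneg_nonpos)

text \<open>All constraints except the normalization are homogeneous. The summand 1 in the bound
  forces \<open>\<kappa> \<le> 1\<close>, hence \<open>\<kappa> ^ p \<le> \<kappa>\<close>, which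
  covers both values of \<open>p\<close>.\<close>

lemma cg_feasible_scale:
  assumes p: "p \<in> {1, 2}" and \<alpha>: "\<And>t. \<alpha> = mult_alpha I S m t" and \<beta>: "\<And>t. \<beta> = mult_beta I S m t"
    and \<tau>: "\<And>t. \<tau> \<le> mult_tau I S yh m t" and signs: "mult_signs I S m"
    and \<kappa>: "0 < \<kappa>" "\<kappa> * (1 + mult_power p (rows S) m) \<le> 1"
  shows "cg_feasible I S p yh (\<kappa> *\<^sub>R \<alpha>, \<kappa> *\<^sub>R \<beta>, \<kappa> * \<tau>) (scale_mult \<kappa> m)"
proof -
  have pos: "0 \<le> mult_power p (rows S) m"
    unfolding mult_power_def by (intro add_nonneg_nonneg sum_nonneg) auto
  have "\<kappa> * 1 \<le> \<kappa> * (1 + mult_power p (rows S) m)"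
    using \<kappa> pos by (intro mult_left_mono) auto
  then have "\<kappa> \<le> 1" using \<kappa> by linarith
  then have "\<kappa> ^ p \<le> \<kappa>" using p \<kappa> by (auto simp: power2_eq_square mult_left_le_one_le)
  then have "\<kappa> ^ p * mult_power p (rows S) m \<le> \<kappa> * mult_power p (rows S) m"
    using pos by (intro mult_right_mono)
  also have "\<dots> \<le> 1" using \<kappa> by (simp add: algebra_simps)
  finally have "\<bar>\<kappa>\<bar> ^ p * mult_power p (rows S) m \<le> 1" using \<kappa> by simp
  then show ?thesis
    unfolding cg_feasible_iff mult_norm_le_1_iff[OF p] mult_scale \<alpha>[symmetric] \<beta>[symmetric]
    using \<tau> \<kappa> signs by (simp add: mult_signs_scale)
qed

section \<open>Compactness of the hull of the disjunction\<close>

lemma closed_hpr_cont_feasible: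
  assumes "closed (K_con I)"
  shows "closed (hpr_cont_feasible I)"
proof -
  let ?S = "P_sys I []"
  have eq: "hpr_cont_feasible I =
      {z. \<forall>r. r \<in> rows ?S \<longrightarrow> hbar ?S r \<le> Mbar ?S r \<bullet> fst z + Nbar ?S r \<bullet> snd z} \<inter>
      (\<lambda>z. M_con I *v fst z + N_con I *v snd z - h_con I) -` K_con I"
    (is "_ = ?R")
  proof -
    have "hpr_cont_feasible I = sys_set I ?S" by (simp add: sys_set_P_sys)
    also have "\<dots> = ?R" by (auto simp: sys_set_def)
    finally show ?thesis .
  qed
  have "closed {z. \<forall>r. r \<in> rows ?S \<longrightarrow> hbar ?S r \<le> Mbar ?S r \<bullet> fst z + Nbar ?S r \<bullet> snd z}"
    by (intro closed_Collect_all closed_Collect_imp open_Collect_const closed_Collect_le continuous_intros)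
  moreover have "closed ((\<lambda>z. M_con I *v fst z + N_con I *v snd z - h_con I) -` K_con I)"
    by (intro closed_vimage assms continuous_intros)
  ultimately show ?thesis unfolding eq by (rule closed_Int)
qed

lemma closed_disj_term: "closed {w. disj_term I yh t w}"
proof (cases t)
  case None
  have "{w. disj_term I yh t w} = {w. q_obj I (snd w) \<le> q_obj I yh}"
    by (auto simp: disj_term_def None)
  moreover have "closed {w. q_obj I (snd w) \<le> q_obj I yh}"
    unfolding q_obj_def
    by (intro closed_Collect_le continuous_on_add continuous_on_inner continuous_on_matrix_vector_mult
        continuous_on_const continuous_on_snd continuous_on_id)
  ultimately show ?thesis by simp
next
  case (Some i)
  have "{w. disj_term I yh t w} = {w. A_real I $ i \<bullet> fst w \<le> disj_rhs I yh i}"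
    by (auto simp: disj_term_def Some)
  moreover have "closed {w. A_real I $ i \<bullet> fst w \<le> disj_rhs I yh i}"
    by (intro closed_Collect_le continuous_on_inner continuous_on_const continuous_on_fst continuous_on_id)
  ultimately show ?thesis by simp
qed

text \<open>There are finitely many disjuncts, each closed inside the unit box, and in finite
  dimension the hull of a compact set is compact.\<close>

lemma compact_disj_hull:
  fixes I :: "('n1::finite,'n2::finite,'n3::finite,'m1::finite,'m2::finite,'m3::finite,'k::finite) ibnp"
  assumes "closed (K_con I)"
  shows "compact (disj_hull I yh (hpr_cont_feasible I))"
  unfolding disj_hull_def
proof (intro compact_convex_hull compact_UN)
  fix t :: "'m2 option"
  have "{z \<in> hpr_cont_feasible I. disj_term I yh t z} =
      unit_box \<inter> (hpr_cont_feasible I \<inter> {z. disj_term I yh t z})"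
    by (auto simp: hpr_cont_feasible_def unit_box_def)
  moreover have "closed (hpr_cont_feasible I \<inter> {z. disj_term I yh t z})"
    by (intro closed_Int closed_hpr_cont_feasible closed_disj_term assms)
  ultimately show "compact {z \<in> hpr_cont_feasible I. disj_term I yh t z}"
    using compact_Int_closed[OF compact_unit_box] by simp
qed auto

section \<open>Binary points: finiteness and extremality\<close>

lemma binary_vec_bounds: "binary_vec x \<Longrightarrow> 0 \<le> x $ j \<and> x $ j \<le> 1"
  by (cases "x $ j = 0") (auto simp: binary_vec_def)

lemma hpr_feasible_subset_cont: "hpr_feasible I \<subseteq> hpr_cont_feasible I"
  by (auto simp: hpr_feasible_def hpr_cont_feasible_def binary_vec_bounds)

lemma finite_binary_vec: "finite {x :: real^'q. binary_vec x}"
proof (rule finite_imageD)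
  show "finite (vec_nth ` {x :: real^'q. binary_vec x})"
    by (rule finite_subset[of _ "PiE UNIV (\<lambda>_. {0, 1})"])
      (auto simp: binary_vec_def intro!: finite_PiE)
qed (auto intro: inj_onI simp: vec_nth_inject)

lemma finite_hpr_feasible: "finite (hpr_feasible I)"
  by (rule finite_subset[OF _ finite_cartesian_product[OF finite_binary_vec finite_binary_vec]])
    (auto simp: hpr_feasible_def)

lemma finite_follower_feasible: "finite (follower_feasible I x)"
  by (rule finite_subset[OF _ finite_binary_vec]) (auto simp: follower_feasible_def)

lemma follower_optimal_nonempty:
  assumes "follower_feasible I x \<noteq> {}"
  shows "follower_optimal I x \<noteq> {}"
proof -
  obtain y where "y \<in> follower_feasible I x" "\<And>w. w \<in> follower_feasible I x \<Longrightarrow> q_obj I y \<le> q_obj I w"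
    using finite_follower_feasible assms by (meson arg_min_if_finite(1) arg_min_least)
  then show ?thesis by (auto simp: follower_optimal_def)
qed


text \<open>The hull lies in the unit box, and 0 or 1 is a proper convex combination of two numbers
  in the unit interval only if both equal it.\<close>

lemma hpr_feasible_extreme_point:
  assumes z: "z \<in> hpr_feasible I"
  shows "z extreme_point_of (convex hull (hpr_cont_feasible I))"
proof -
  have sub: "convex hull (hpr_cont_feasible I) \<subseteq> unit_box"
    using convex_unit_box by (intro hull_minimal) (auto simp: hpr_cont_feasible_def unit_box_def)
  have coord: "v = c \<and> w = c" if "c = 0 \<or> c = 1" "c = (1 - u) * v + u * w" "0 < u" "u < 1"
    "0 \<le> v" "v \<le> 1" "0 \<le> w" "w \<le> 1" for c u v w :: real
  proof -
    have "(1 - u) * v \<le> (1 - u)" "u * w \<le> u" "0 \<le> (1 - u) * v" "0 \<le> u * w"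
      using that by (auto intro: mult_left_le)
    with that show ?thesis
      by (smt (verit, best) mult_cancel_left1 mult_eq_0_iff)
  qed
  obtain x y where xy: "z = (x, y)" by (metis surj_pair)
  have bin: "x $ j = 0 \<or> x $ j = 1" "y $ i = 0 \<or> y $ i = 1" for i j
    using z by (auto simp: hpr_feasible_def binary_vec_def xy)
  have "z \<in> convex hull (hpr_cont_feasible I)"
    by (intro hull_inc subsetD[OF hpr_feasible_subset_cont z])
  moreover have "z \<notin> open_segment a b"
    if a: "a \<in> unit_box" and b: "b \<in> unit_box" for a b
  proof
    assume "z \<in> open_segment a b"
    then obtain u where ab: "a \<noteq> b" and u: "0 < u" "u < 1" "z = (1 - u) *\<^sub>R a + u *\<^sub>R b"
      by (auto simp: in_segment)
    have "fst a $ j = fst b $ j" for j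
      using coord[of "x $ j" u "fst a $ j" "fst b $ j"] u bin a b
      by (cases a; cases b) (auto simp: xy unit_box_def)
    moreover have "snd a $ j = snd b $ j" for j
      using coord[of "y $ j" u "snd a $ j" "snd b $ j"] u bin a b
      by (cases a; cases b) (auto simp: xy unit_box_def)
    ultimately show False using ab by (simp add: prod_eq_iff vec_eq_iff)
  qed
  ultimately show ?thesis using sub unfolding extreme_point_of_def by blast
qed

lemma mem_sys_set_of_R_feasible: "z \<in> R_feasible I cs \<Longrightarrow> z \<in> sys_set I (P_sys I cs)"
  using hpr_feasible_subset_cont by (auto simp: R_feasible_def sys_set_P_sys)

text \<open>Extremality passes to the smaller hull, and an extreme point of a hull belongs to the
  generating set, so a point of the hull would satisfy a single term. Term 0 contradicts the strict
  inequality for \<open>q_obj\<close>; a term \<open>Some i\<close> contradicts row \<open>i\<close>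
  of follower feasibility because of the -1 in \<open>disj_rhs\<close>.\<close>

lemma not_mem_disj_hull:
  assumes z: "(x, y) \<in> hpr_feasible I" and yh: "yh \<in> follower_feasible I x" "q_obj I yh < q_obj I y"
  shows "(x, y) \<notin> disj_hull I yh (hpr_cont_feasible I)"
proof
  let ?U = "\<Union>t. {w \<in> hpr_cont_feasible I. disj_term I yh t w}"
  assume mem: "(x, y) \<in> disj_hull I yh (hpr_cont_feasible I)"
  have "convex hull ?U \<subseteq> convex hull (hpr_cont_feasible I)"
    by (intro hull_mono) auto
  then have "(x, y) extreme_point_of (convex hull ?U)"
    using mem hpr_feasible_extreme_point[OF z] unfolding disj_hull_def extreme_point_of_def by blast
  then have "(x, y) \<in> ?U" by (rule extreme_point_of_convex_hull)
  then obtain t where t: "disj_term I yh t (x, y)" by blast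
  show False
  proof (cases t)
    case None
    then show ?thesis using t yh by (simp add: disj_term_def)
  next
    case (Some i)
    have "f_real I $ i \<le> (A_real I *v x + B_real I *v yh) $ i"
      using yh unfolding follower_feasible_def less_eq_vec_def by blast
    then show ?thesis using t Some
      by (simp add: disj_term_def disj_rhs_def matrix_vector_mul_component)
  qed
qed

text \<open>\<open>term_multipliers\<close> is used once per disjunct, with the cone
  \<open>soc_Q\<close> for term 0 and the nonnegative reals for each follower row. The multipliers
  are chosen before \<open>cs\<close>.\<close>

lemma ex_multipliers:
  fixes I :: "('n1::finite,'n2::finite,'n3::finite,'m1::finite,'m2::finite,'m3::finite,'k::finite) ibnp"
  assumes K: "closed_convex_cone (K_con I)"
    and strict: "\<And>w. w \<in> disj_hull I yh (hpr_cont_feasible I) \<Longrightarrow> \<tau> < (\<alpha>, \<beta>) \<bullet> w"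
  obtains m :: "(('n1,'n2,'m1,'m2,'m3) row_ix, 'n3, 'm2, 'k) mult" where
    "\<And>t k. pbar m t (CutRow k) = 0" "\<And>cs. mult_signs I (P_sys I cs) m"
    "\<And>cs t. \<alpha> = mult_alpha I (P_sys I cs) m t" "\<And>cs t. \<beta> = mult_beta I (P_sys I cs) m t"
    "\<And>cs t. \<tau> \<le> mult_tau I (P_sys I cs) yh m t"
proof -
  have strict': "\<tau> < \<alpha> \<bullet> x + \<beta> \<bullet> y" if "(x, y) \<in> hpr_cont_feasible I" "disj_term I yh t (x, y)" for x y t
  proof -
    have "(x, y) \<in> disj_hull I yh (hpr_cont_feasible I)"
      unfolding disj_hull_def using that by (intro hull_inc) auto
    from strict[OF this] show ?thesis by simp
  qed
  have lin0: "linear (\<lambda>w :: (real^'n1) \<times> (real^'n2). Dtil I (snd w))"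
    by (rule linearI) (simp_all add: Dtil_def matrix_vector_right_distrib matrix_vector_mult_scaleR
        inner_add_right algebra_simps)
  obtain pb0 pt0 d0 where 0: "\<And>r. 0 \<le> pb0 r" "pt0 \<in> dual_cone (K_con I)" "d0 \<in> dual_cone soc_Q"
      "\<And>k. pb0 (CutRow k) = 0"
      "\<And>cs. \<alpha> = (\<Sum>r\<in>rows (P_sys I cs). pb0 r *\<^sub>R Mbar (P_sys I cs) r) + transpose (M_con I) *v pt0 + 0"
      "\<And>cs. \<beta> = (\<Sum>r\<in>rows (P_sys I cs). pb0 r *\<^sub>R Nbar (P_sys I cs) r) + transpose (N_con I) *v pt0 + Dtil_transpose I d0"
      "\<And>cs. \<tau> \<le> (\<Sum>r\<in>rows (P_sys I cs). pb0 r * hbar (P_sys I cs) r) + pt0 \<bullet> h_con I + d0 \<bullet> ctil I yh"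
  proof (rule term_multipliers[OF K closed_convex_cone_soc_Q lin0, where Lx' = "\<lambda>_. 0" and Ly' = "Dtil_transpose I"
        and b = "ctil I yh" and \<tau> = \<tau> and \<alpha> = \<alpha> and \<beta> = \<beta>])
    show "d \<bullet> Dtil I (snd (x, y)) = 0 \<bullet> x + Dtil_transpose I d \<bullet> y" for d x y
      by (simp add: inner_Dtil)
    show "\<tau> < \<alpha> \<bullet> x + \<beta> \<bullet> y" if "(x, y) \<in> hpr_cont_feasible I" "Dtil I (snd (x, y)) - ctil I yh \<in> soc_Q" for x y
      using that by (intro strict'[where t = None]) (auto simp: disj_term_def Dtil_in_soc_Q_iff)
  qed blast
  have "\<forall>i. \<exists>pb pt s. (\<forall>r. 0 \<le> pb r) \<and> pt \<in> dual_cone (K_con I) \<and> s \<le> 0 \<and> (\<forall>k. pb (CutRow k) = 0) \<and>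
      (\<forall>cs. \<alpha> = (\<Sum>r\<in>rows (P_sys I cs). pb r *\<^sub>R Mbar (P_sys I cs) r) + transpose (M_con I) *v pt + s *\<^sub>R A_real I $ i) \<and>
      (\<forall>cs. \<beta> = (\<Sum>r\<in>rows (P_sys I cs). pb r *\<^sub>R Nbar (P_sys I cs) r) + transpose (N_con I) *v pt) \<and>
      (\<forall>cs. \<tau> \<le> (\<Sum>r\<in>rows (P_sys I cs). pb r * hbar (P_sys I cs) r) + pt \<bullet> h_con I + s * disj_rhs I yh i)" (is "\<forall>i. ?X i")
  proof
    fix i
    have lin: "linear (\<lambda>w :: (real^'n1) \<times> (real^'n2). - (A_real I $ i \<bullet> fst w))"
      by (rule linearI) (simp_all add: inner_add_right)
    obtain pb :: "('n1,'n2,'m1,'m2,'m3) row_ix \<Rightarrow> real" and pt and d :: real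
      where "\<And>r. 0 \<le> pb r" "pt \<in> dual_cone (K_con I)" "d \<in> dual_cone {0..}" "\<And>k. pb (CutRow k) = 0"
        "\<And>cs. \<alpha> = (\<Sum>r\<in>rows (P_sys I cs). pb r *\<^sub>R Mbar (P_sys I cs) r) + transpose (M_con I) *v pt + (- d) *\<^sub>R A_real I $ i"
        "\<And>cs. \<beta> = (\<Sum>r\<in>rows (P_sys I cs). pb r *\<^sub>R Nbar (P_sys I cs) r) + transpose (N_con I) *v pt + 0"
        "\<And>cs. \<tau> \<le> (\<Sum>r\<in>rows (P_sys I cs). pb r * hbar (P_sys I cs) r) + pt \<bullet> h_con I + d \<bullet> (- disj_rhs I yh i)"
    proof (rule term_multipliers[OF K closed_convex_cone_nonneg_real lin, where Lx' = "\<lambda>d. (- d) *\<^sub>R A_real I $ i"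
          and Ly' = "\<lambda>_. 0" and b = "- disj_rhs I yh i" and \<tau> = \<tau> and \<alpha> = \<alpha> and \<beta> = \<beta>])
      show "d \<bullet> - (A_real I $ i \<bullet> fst (x, y)) = (- d) *\<^sub>R A_real I $ i \<bullet> x + 0 \<bullet> y" for d x y
        by simp
      show "\<tau> < \<alpha> \<bullet> x + \<beta> \<bullet> y" if "(x, y) \<in> hpr_cont_feasible I"
        "- (A_real I $ i \<bullet> fst (x, y)) - - disj_rhs I yh i \<in> {0..}" for x y
        using that by (intro strict'[where t = "Some i"]) (auto simp: disj_term_def)
    qed blast
    \<comment> \<open>The row was negated to fit the nonnegative cone, so \<open>sig\<close> is the
      negative of the dual variable \<open>d\<close>.\<close>
    then show "?X i"
      by (intro exI[of _ pb] exI[of _ pt] exI[of _ "- d"])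
        (simp add: dual_cone_nonneg_real del: transpose_matrix_vector)
  qed
  then obtain pb pt s where i: "\<And>i r. 0 \<le> pb i r" "\<And>i. pt i \<in> dual_cone (K_con I)" "\<And>i. s i \<le> 0"
      "\<And>i k. pb i (CutRow k) = 0"
      "\<And>i cs. \<alpha> = (\<Sum>r\<in>rows (P_sys I cs). pb i r *\<^sub>R Mbar (P_sys I cs) r) + transpose (M_con I) *v pt i + s i *\<^sub>R A_real I $ i"
      "\<And>i cs. \<beta> = (\<Sum>r\<in>rows (P_sys I cs). pb i r *\<^sub>R Nbar (P_sys I cs) r) + transpose (N_con I) *v pt i"
      "\<And>i cs. \<tau> \<le> (\<Sum>r\<in>rows (P_sys I cs). pb i r * hbar (P_sys I cs) r) + pt i \<bullet> h_con I + s i * disj_rhs I yh i"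
    unfolding choice_iff by blast
  define m :: "(('n1,'n2,'m1,'m2,'m3) row_ix, 'n3, 'm2, 'k) mult" where
    "m = \<lparr>pbar = case_option pb0 pb, ptil = case_option pt0 pt, sig = (\<chi> i. s i), rho = d0\<rparr>"
  show thesis
  proof (rule that[of m])
    fix cs and t :: "'m2 option"
    show "pbar m t (CutRow k) = 0" for k by (cases t) (simp_all add: m_def 0 i)
    show "mult_signs I (P_sys I cs) m" using 0(1-3) i(1-3)
      by (auto simp: m_def mult_signs_def split: option.split)
    show "\<alpha> = mult_alpha I (P_sys I cs) m t"
      unfolding mult_alpha_def m_def by (cases t; simp only: mult.select_convs option.case vec_lambda_beta; rule 0 i)
    show "\<beta> = mult_beta I (P_sys I cs) m t"
      unfolding mult_beta_def m_def
      by (cases t; simp only: mult.select_convs option.case add_0_right; rule 0 i)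
    show "\<tau> \<le> mult_tau I (P_sys I cs) yh m t"
      unfolding mult_tau_def m_def by (cases t; simp only: mult.select_convs option.case vec_lambda_beta; rule 0 i)
  qed
qed

text \<open>The multipliers of the cut rows vanish, so the same multipliers can be used, with the same
  normalization, whatever cuts have been added. This makes the bound uniform in \<open>cs\<close>.\<close>

lemma ex_uniform_violation:
  fixes I :: "('n1::finite,'n2::finite,'n3::finite,'m1::finite,'m2::finite,'m3::finite,'k::finite) ibnp"
  assumes K: "closed_convex_cone (K_con I)" and p: "p \<in> {1, 2}"
    and z: "(x, y) \<in> hpr_feasible I" and yh: "yh \<in> follower_feasible I x" "q_obj I yh < q_obj I y"
  shows "\<exists>\<delta>>0. \<forall>cs. \<exists>c m. cg_feasible I (P_sys I cs) p yh c m \<and> \<delta> \<le> cut_violation (x, y) c"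
proof -
  have "closed (K_con I)" using K by (simp add: closed_convex_cone_def)
  then have "closed (disj_hull I yh (hpr_cont_feasible I))"
    by (rule compact_imp_closed[OF compact_disj_hull])
  moreover have "convex (disj_hull I yh (hpr_cont_feasible I))"
    by (simp add: disj_hull_def)
  ultimately obtain n \<tau> where n: "n \<bullet> (x, y) < \<tau>"
    "\<forall>w\<in>disj_hull I yh (hpr_cont_feasible I). n \<bullet> w > \<tau>"
    using separating_hyperplane_closed_point not_mem_disj_hull[OF z yh] by blast
  obtain \<alpha> \<beta> where n_eq: "n = (\<alpha>, \<beta>)" by (metis surj_pair)
  obtain m :: "(('n1,'n2,'m1,'m2,'m3) row_ix, 'n3, 'm2, 'k) mult" where m:
    "\<And>t k. pbar m t (CutRow k) = 0" "\<And>cs. mult_signs I (P_sys I cs) m"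
    "\<And>cs t. \<alpha> = mult_alpha I (P_sys I cs) m t" "\<And>cs t. \<beta> = mult_beta I (P_sys I cs) m t"
    "\<And>cs t. \<tau> \<le> mult_tau I (P_sys I cs) yh m t"
    using ex_multipliers[OF K, where \<alpha> = \<alpha> and \<beta> = \<beta> and \<tau> = \<tau> and yh = yh] n n_eq by metis
  define N where "N = mult_power p (rows (P_sys I [])) m"
  \<comment> \<open>Since \<open>p\<close> is positive, the zero multipliers of the cut rows
    contribute \<open>0 ^ p = 0\<close>, and the power sum is the same number \<open>N\<close> for
    every list of cuts.\<close>
  have "0 < p" using p by auto
  then have N: "mult_power p (rows (P_sys I cs)) m = N" for cs
    by (simp add: N_def mult_power_def sum_rows_P_sys m(1) power_0_left)
  have "0 \<le> N" unfolding N_def mult_power_def by (intro add_nonneg_nonneg sum_nonneg) auto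
  define \<kappa> where "\<kappa> = 1 / (1 + N)"
  have \<kappa>: "0 < \<kappa>" "\<kappa> * (1 + N) \<le> 1" using \<open>0 \<le> N\<close> by (auto simp: \<kappa>_def)
  have "cg_feasible I (P_sys I cs) p yh (\<kappa> *\<^sub>R \<alpha>, \<kappa> *\<^sub>R \<beta>, \<kappa> * \<tau>) (scale_mult \<kappa> m)" for cs
    by (rule cg_feasible_scale[OF p m(3-5) m(2) \<kappa>(1)]) (simp add: N \<kappa>)
  moreover have "cut_violation (x, y) (\<kappa> *\<^sub>R \<alpha>, \<kappa> *\<^sub>R \<beta>, \<kappa> * \<tau>) = \<kappa> * (\<tau> - n \<bullet> (x, y))"
    by (simp add: cut_violation_def n_eq algebra_simps)
  moreover have "0 < \<kappa> * (\<tau> - n \<bullet> (x, y))" using n \<kappa> by simp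
  ultimately show ?thesis by (intro exI[of _ "\<kappa> * (\<tau> - n \<bullet> (x, y))"]) (metis order_refl)
qed

subsection \<open>The cutting-plane algorithm\<close>

lemma binary_vec_Ints: "binary_vec x \<Longrightarrow> x $ j \<in> \<int>"
  by (cases "x $ j = 0") (auto simp: binary_vec_def)

text \<open>If \<open>yh\<close> is feasible for the follower at \<open>x\<close>, optimality of
  \<open>y\<close> gives term 0. Otherwise some follower row fails, and since both sides are
  integers it fails by at least 1.\<close>

lemma disj_term_cases:
  assumes w: "(x, y) \<in> bilevel_feasible I" and yh: "yh \<in> poly_Y I" "binary_vec yh"
  shows "\<exists>t. disj_term I yh t (x, y)"
proof (cases "f_real I \<le> A_real I *v x + B_real I *v yh")
  case True
  then have "yh \<in> follower_feasible I x" using yh by (simp add: follower_feasible_def)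
  then have "q_obj I y \<le> q_obj I yh" using w by (auto simp: bilevel_feasible_def follower_optimal_def)
  then show ?thesis by (intro exI[of _ None]) (simp add: disj_term_def)
next
  case False
  then obtain i where "(A_real I *v x + B_real I *v yh) $ i < f_real I $ i"
    by (auto simp: less_eq_vec_def not_le)
  then have i: "A_real I $ i \<bullet> x + B_real I $ i \<bullet> yh < f_real I $ i"
    by (simp add: matrix_vector_mul_component)
  have "binary_vec x" using w by (simp add: bilevel_feasible_def)
  have "A_real I $ i \<bullet> x \<in> \<int>"
    unfolding inner_vec_def using binary_vec_Ints[OF \<open>binary_vec x\<close>]
    by (auto simp: A_real_def intro!: Ints_sum Ints_mult)
  moreover have "B_real I $ i \<bullet> yh \<in> \<int>"
    unfolding inner_vec_def using binary_vec_Ints[OF yh(2)]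
    by (auto simp: B_real_def intro!: Ints_sum Ints_mult)
  ultimately obtain a b where ab: "A_real I $ i \<bullet> x = of_int a" "B_real I $ i \<bullet> yh = of_int b"
    by (auto elim!: Ints_cases)
  have "a + b < f_fol I $ i" using i unfolding ab by (simp add: f_real_def flip: of_int_add)
  then have "a \<le> f_fol I $ i - 1 - b" by simp
  then have "real_of_int a \<le> real_of_int (f_fol I $ i - 1 - b)" by (simp only: of_int_le_iff)
  then have "A_real I $ i \<bullet> x \<le> disj_rhs I yh i" by (simp add: ab disj_rhs_def f_real_def)
  then show ?thesis by (intro exI[of _ "Some i"]) (simp add: disj_term_def)
qed

lemma bilevel_feasible_subset_hpr: "bilevel_feasible I \<subseteq> hpr_feasible I"
  by (auto simp: bilevel_feasible_def hpr_feasible_def follower_optimal_def follower_feasible_def)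

section \<open>Outcomes of a separation call\<close>

lemma enumerated_subset: "enumerated I st x E \<Longrightarrow> E \<subseteq> follower_feasible I x"
  by (cases st) (auto simp: enumerated_def follower_optimal_def)

text \<open>A single optimal follower solution is an admissible enumeration under both
  strategies.\<close>

lemma ex_enumerated:
  assumes "follower_feasible I x \<noteq> {}"
  shows "\<exists>E yh. enumerated I st x E \<and> E = {yh}"
proof -
  obtain yh where "yh \<in> follower_optimal I x" using follower_optimal_nonempty[OF assms] by blast
  then have "enumerated I st x {yh}" by (cases st) (auto simp: enumerated_def follower_optimal_def)
  then show ?thesis by blast
qed

lemma enumerated_optimal: "enumerated I st x E \<Longrightarrow> \<exists>yh\<in>E. yh \<in> follower_optimal I x"
  by (cases st) (auto simp: enumerated_def)

lemma not_satisfies_cut_iff: "\<not> satisfies_cut z c \<longleftrightarrow> 0 < cut_violation z c"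
  by (cases z; cases c) (auto simp: satisfies_cut_def cut_violation_def)

lemma separation_SomeD:
  assumes "separation I st p \<epsilon> S z (Some c)"
  obtains x y yh where "z = (x, y)" "yh \<in> follower_feasible I x" "q_obj I yh < q_obj I y"
    "cg_optimal I S p yh z c" "\<epsilon> < cut_violation z c"
  using assms enumerated_subset by cases blast

lemma separation_disjunctive_cut:
  assumes "separation I st p \<epsilon> S z (Some c)" and "0 < \<epsilon>"
  shows "disjunctive_cut I (sys_set I S) z c"
proof -
  obtain x y yh where z: "z = (x, y)" and yh: "yh \<in> follower_feasible I x"
    and c: "cg_optimal I S p yh z c" "\<epsilon> < cut_violation z c"
    using separation_SomeD[OF assms(1)] .
  obtain m where "cg_feasible I S p yh c m" using c(1) by (auto simp: cg_optimal_def)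
  then have "\<forall>w \<in> disj_hull I yh (sys_set I S). satisfies_cut w c"
    using cg_feasible_valid_hull by blast
  moreover have "yh \<in> poly_Y I" "binary_vec yh" using yh by (auto simp: follower_feasible_def)
  moreover have "\<not> satisfies_cut z c" using c assms(2) by (simp add: not_satisfies_cut_iff)
  ultimately show ?thesis unfolding disjunctive_cut_def by blast
qed

lemma disjunctive_cut_bilevel_feasible:
  assumes cut: "disjunctive_cut I (sys_set I S) z c"
    and w: "w \<in> bilevel_feasible I" "w \<in> sys_set I S"
  shows "satisfies_cut w c"
proof -
  obtain yh where yh: "yh \<in> poly_Y I" "binary_vec yh"
    and valid: "\<forall>w \<in> disj_hull I yh (sys_set I S). satisfies_cut w c"
    using cut by (auto simp: disjunctive_cut_def)
  obtain t where "disj_term I yh t w"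
    using disj_term_cases[of "fst w" "snd w"] w(1) yh by auto
  then have "w \<in> disj_hull I yh (sys_set I S)"
    unfolding disj_hull_def using w(2) by (intro hull_inc) auto
  then show ?thesis using valid by blast
qed

text \<open>Induction along the run: bilevel feasible points satisfy the earlier cuts, hence lie in
  the current P, for which the next cut is a valid disjunctive cut.\<close>

lemma bilevel_feasible_subset_R_feasible:
  assumes "cp_reachable I st p \<epsilon> cs" and "0 < \<epsilon>"
  shows "bilevel_feasible I \<subseteq> R_feasible I cs"
  using assms(1) unfolding cp_reachable_def
proof (induction rule: rtranclp_induct)
  case base
  show ?case using bilevel_feasible_subset_hpr by (auto simp: R_feasible_def)
next
  case (step cs cs')
  obtain z c where sep: "separation I st p \<epsilon> (P_sys I cs) z (Some c)" and cs': "cs' = cs @ [c]"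
    using step(2) by (auto simp: cp_step_def)
  have "satisfies_cut w c" if "w \<in> bilevel_feasible I" for w
    using disjunctive_cut_bilevel_feasible[OF separation_disjunctive_cut[OF sep assms(2)] that]
      mem_sys_set_of_R_feasible step.IH that by blast
  then show ?case using step.IH by (auto simp: R_feasible_def cs')
qed

lemma cp_step_psubset:
  assumes "cp_step I st p \<epsilon> cs cs'" and "0 < \<epsilon>"
  shows "R_feasible I cs' \<subset> R_feasible I cs"
proof -
  obtain z c where z: "z \<in> R_optimal I cs" and sep: "separation I st p \<epsilon> (P_sys I cs) z (Some c)"
    and cs': "cs' = cs @ [c]"
    using assms(1) by (auto simp: cp_step_def)
  have "\<not> satisfies_cut z c"
    using separation_disjunctive_cut[OF sep assms(2)] by (simp add: disjunctive_cut_def)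
  then show ?thesis using z by (auto simp: R_optimal_def R_feasible_def cs')
qed

lemma finite_R_feasible: "finite (R_feasible I cs)"
  by (rule finite_subset[OF _ finite_hpr_feasible]) (auto simp: R_feasible_def)

text \<open>Each step removes at least the current optimal point from a finite set, so its
  cardinality would decrease forever.\<close>

lemma cp_terminates_pos:
  assumes "0 < \<epsilon>"
  shows "cp_terminates I st p \<epsilon>"
  unfolding cp_terminates_def
proof
  assume "\<exists>run. run 0 = [] \<and> (\<forall>k. cp_step I st p \<epsilon> (run k) (run (Suc k)))"
  then obtain run where run: "\<And>k. cp_step I st p \<epsilon> (run k) (run (Suc k))" by blast
  have "card (R_feasible I (run (Suc k))) < card (R_feasible I (run k))" for k
    by (intro psubset_card_mono finite_R_feasible cp_step_psubset[OF run assms])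
  then show False
    using wf_no_infinite_down_chainE[OF wf_less, of "\<lambda>k. card (R_feasible I (run k))"] by blast
qed

lemma R_optimal_nonempty:
  assumes "R_feasible I cs \<noteq> {}"
  shows "R_optimal I cs \<noteq> {}"
proof -
  obtain z where "z \<in> R_feasible I cs" "\<And>w. w \<in> R_feasible I cs \<Longrightarrow> leader_obj I z \<le> leader_obj I w"
    using finite_R_feasible assms by (meson arg_min_if_finite(1) arg_min_least)
  then show ?thesis unfolding R_optimal_def by blast
qed

lemma R_optimal_subset_hpr: "R_optimal I cs \<subseteq> hpr_feasible I"
  by (auto simp: R_optimal_def R_feasible_def)

lemma mem_follower_feasible_of_hpr: "(x, y) \<in> hpr_feasible I \<Longrightarrow> y \<in> follower_feasible I x"
  by (simp add: hpr_feasible_def follower_feasible_def)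

text \<open>The procedure cannot get stuck: with one follower optimum and one optimal cut, the
  outcome depends only on whether the two strict inequalities hold.\<close>

lemma ex_separation:
  assumes p: "p \<in> {1, 2}" and z: "z \<in> hpr_feasible I"
  shows "\<exists>out. separation I st p \<epsilon> (P_sys I cs) z out"
proof -
  obtain x y where xy: "z = (x, y)" by (metis surj_pair)
  have "follower_feasible I x \<noteq> {}" using mem_follower_feasible_of_hpr z xy by blast
  then obtain yh where E: "enumerated I st x {yh}" using ex_enumerated by metis
  obtain c where c: "cg_optimal I (P_sys I cs) p yh (x, y) c"
    using ex_cg_optimal[OF finite_rows_P_sys p] by blast
  show ?thesis
  proof (cases "q_obj I yh < q_obj I y \<and> \<epsilon> < cut_violation (x, y) c")
    case True
    then show ?thesis using separation.found[OF E _ _ c] xy by blast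
  next
    case False
    then have "separation I st p \<epsilon> (P_sys I cs) (x, y) None"
      using c by (intro separation.nothing[OF E] exI[of _ c]) auto
    then show ?thesis using xy by blast
  qed
qed

lemma ex_uniform_violation_all:
  fixes I :: "('n1::finite,'n2::finite,'n3::finite,'m1::finite,'m2::finite,'m3::finite,'k::finite) ibnp"
  assumes K: "closed_convex_cone (K_con I)"
  obtains \<epsilon>0 where "0 < \<epsilon>0"
    "\<And>p x y yh cs. p \<in> {1, 2} \<Longrightarrow> (x, y) \<in> hpr_feasible I \<Longrightarrow> yh \<in> follower_feasible I x \<Longrightarrow>
       q_obj I yh < q_obj I y \<Longrightarrow>
       \<exists>c m. cg_feasible I (P_sys I cs) p yh c m \<and> \<epsilon>0 < cut_violation (x, y) c"
proof -
  define T where "T = {(p :: nat, (x, y), yh). p \<in> {1, 2} \<and> (x, y) \<in> hpr_feasible I \<and>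
    yh \<in> follower_feasible I x \<and> q_obj I yh < q_obj I y}"
  have "finite T"
    by (rule finite_subset[of _ "{1, 2} \<times> hpr_feasible I \<times> {yh. binary_vec yh}"])
      (auto simp: T_def follower_feasible_def finite_hpr_feasible finite_binary_vec)
  have "\<forall>u\<in>T. \<exists>\<delta>>0. \<forall>cs. \<exists>c m. cg_feasible I (P_sys I cs) (fst u) (snd (snd u)) c m \<and>
      \<delta> \<le> cut_violation (fst (snd u)) c"
    unfolding T_def using ex_uniform_violation[OF K] by auto
  then obtain \<delta> where \<delta>: "\<forall>u\<in>T. 0 < \<delta> u \<and> (\<forall>cs. \<exists>c m.
      cg_feasible I (P_sys I cs) (fst u) (snd (snd u)) c m \<and> \<delta> u \<le> cut_violation (fst (snd u)) c)"
    unfolding bchoice_iff by blast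
  \<comment> \<open>The element 1 keeps the minimum defined when \<open>T\<close> is empty, and
    halving makes the bound strict.\<close>
  define \<epsilon>0 where "\<epsilon>0 = Min (insert 1 (\<delta> ` T)) / 2"
  have pos: "0 < Min (insert 1 (\<delta> ` T))"
    using \<delta> \<open>finite T\<close> by (subst Min_gr_iff) auto
  have lt: "\<epsilon>0 < \<delta> u" if "u \<in> T" for u
  proof -
    have "Min (insert 1 (\<delta> ` T)) \<le> \<delta> u" using that \<open>finite T\<close> by (intro Min_le) auto
    then show ?thesis using pos by (simp add: \<epsilon>0_def)
  qed
  show thesis
  proof (rule that[of \<epsilon>0])
    show "0 < \<epsilon>0" using pos by (simp add: \<epsilon>0_def)
  next
    fix p :: nat and x y yh cs
    assume "p \<in> {1, 2}" "(x, y) \<in> hpr_feasible I" "yh \<in> follower_feasible I x" "q_obj I yh < q_obj I y"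
    then have u: "(p, (x, y), yh) \<in> T" by (simp add: T_def)
    then obtain c m where "cg_feasible I (P_sys I cs) p yh c m" "\<delta> (p, (x, y), yh) \<le> cut_violation (x, y) c"
      using \<delta> by fastforce
    then show "\<exists>c m. cg_feasible I (P_sys I cs) p yh c m \<and> \<epsilon>0 < cut_violation (x, y) c"
      using lt[OF u] by (meson less_le_trans)
  qed
qed

text \<open>Every enumeration contains an optimal follower solution. Were it strictly better than
  \<open>y\<close>, the optimal violation would exceed \<epsilon>, contrary to the outcome; hence
  \<open>y\<close> is optimal as well.\<close>

lemma separation_None_bilevel_feasible:
  assumes sep: "separation I st p \<epsilon> S z None" and z: "z \<in> hpr_feasible I"
    and viol: "\<And>x y yh. (x, y) \<in> hpr_feasible I \<Longrightarrow> yh \<in> follower_feasible I x \<Longrightarrow>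
       q_obj I yh < q_obj I y \<Longrightarrow> \<exists>c m. cg_feasible I S p yh c m \<and> \<epsilon> < cut_violation (x, y) c"
  shows "z \<in> bilevel_feasible I"
proof -
  obtain x y E where xy: "z = (x, y)" and E: "enumerated I st x E"
    and none: "\<And>yh. yh \<in> E \<Longrightarrow> q_obj I yh < q_obj I y \<Longrightarrow>
      \<exists>c. cg_optimal I S p yh (x, y) c \<and> cut_violation (x, y) c \<le> \<epsilon>"
    using sep by cases (blast | simp)+
  obtain yh where yh: "yh \<in> E" "yh \<in> follower_optimal I x"
    using enumerated_optimal E by blast
  then have yh': "yh \<in> follower_feasible I x" by (simp add: follower_optimal_def)
  have "\<not> q_obj I yh < q_obj I y"
  proof
    assume lt: "q_obj I yh < q_obj I y"
    obtain c where c: "cg_optimal I S p yh (x, y) c" "cut_violation (x, y) c \<le> \<epsilon>"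
      using none[OF yh(1) lt] by blast
    obtain c' m where "cg_feasible I S p yh c' m" "\<epsilon> < cut_violation (x, y) c'"
      using viol[OF _ yh' lt] z xy by blast
    moreover from this have "cut_violation (x, y) c' \<le> cut_violation (x, y) c"
      using c(1) unfolding cg_optimal_def by blast
    ultimately show False using c(2) by simp
  qed
  then have "y \<in> follower_optimal I x"
    using yh mem_follower_feasible_of_hpr z xy
    by (auto simp: follower_optimal_def intro: order_trans)
  then show ?thesis
    using z xy by (auto simp: bilevel_feasible_def hpr_feasible_def)
qed

text \<open>Termination and validity are asserted for every positive tolerance. Detection of all
  bilevel infeasible points is asserted below a threshold depending only on the instance, as a large
  tolerance can reject genuine cuts.\<close>

theorem mainTheorem5:
  fixes I :: "('n1::finite,'n2::finite,'n3::finite,'m1::finite,'m2::finite,'m3::finite,'k::finite) ibnp"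
  assumes "ibnp_data I" and "standing_assumptions I"
  shows "(\<forall>st. \<forall>p\<in>{1, 2}. \<forall>\<epsilon>>0.
            cp_terminates I st p \<epsilon> \<and>
            (\<forall>cs. cp_reachable I st p \<epsilon> cs \<longrightarrow>
               bilevel_feasible I \<subseteq> R_feasible I cs \<and>
               (R_feasible I cs \<noteq> {} \<longrightarrow> R_optimal I cs \<noteq> {}) \<and>
               (\<forall>z\<in>R_optimal I cs.
                  z extreme_point_of (convex hull (hpr_cont_feasible I)) \<and>
                  (\<exists>out. separation I st p \<epsilon> (P_sys I cs) z out) \<and>
                  (\<forall>c. separation I st p \<epsilon> (P_sys I cs) z (Some c) \<longrightarrow>
                     disjunctive_cut I (sys_set I (P_sys I cs)) z c)))) \<and>
         (\<exists>\<epsilon>0>0. \<forall>st. \<forall>p\<in>{1, 2}. \<forall>\<epsilon>. 0 < \<epsilon> \<and> \<epsilon> \<le> \<epsilon>0 \<longrightarrow>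
            (\<forall>cs. cp_reachable I st p \<epsilon> cs \<longrightarrow>
               (\<forall>z\<in>R_optimal I cs. z \<notin> bilevel_feasible I \<longrightarrow>
                  (\<forall>out. separation I st p \<epsilon> (P_sys I cs) z out \<longrightarrow> (\<exists>c. out = Some c)))) \<and>
            (\<forall>z. cp_returns I st p \<epsilon> z \<longrightarrow> z \<in> bilevel_optimal I))"
proof (intro conjI)
  have "closed_convex_cone (K_con I)"
    using assms(1) by (simp add: ibnp_data_def closed_convex_cone_soc_product)
  then obtain \<epsilon>0 where \<epsilon>0: "0 < \<epsilon>0"
    and viol: "\<And>p x y yh cs. p \<in> {1, 2} \<Longrightarrow> (x, y) \<in> hpr_feasible I \<Longrightarrow> yh \<in> follower_feasible I x \<Longrightarrow>
       q_obj I yh < q_obj I y \<Longrightarrow>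
       \<exists>c m. cg_feasible I (P_sys I cs) p yh c m \<and> \<epsilon>0 < cut_violation (x, y) c"
    by (rule ex_uniform_violation_all) blast
  have sep: "z \<in> bilevel_feasible I"
    if "p \<in> {1, 2}" "\<epsilon> \<le> \<epsilon>0" "z \<in> R_optimal I cs" "separation I st p \<epsilon> (P_sys I cs) z None"
    for st p \<epsilon> cs z
  proof (rule separation_None_bilevel_feasible[OF that(4)])
    show "z \<in> hpr_feasible I" using that R_optimal_subset_hpr by blast
    show "\<exists>c m. cg_feasible I (P_sys I cs) p yh c m \<and> \<epsilon> < cut_violation (x, y) c"
      if "(x, y) \<in> hpr_feasible I" "yh \<in> follower_feasible I x" "q_obj I yh < q_obj I y" for x y yh
      using viol[OF \<open>p \<in> {1, 2}\<close> that] \<open>\<epsilon> \<le> \<epsilon>0\<close> by (meson le_less_trans)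
  qed
  have opt: "z \<in> bilevel_optimal I"
    if p: "p \<in> {1, 2}" and \<epsilon>: "0 < \<epsilon>" "\<epsilon> \<le> \<epsilon>0" and ret: "cp_returns I st p \<epsilon> z" for st p \<epsilon> z
  proof -
    obtain cs where cs: "cp_reachable I st p \<epsilon> cs" "z \<in> R_optimal I cs"
      "separation I st p \<epsilon> (P_sys I cs) z None"
      using ret by (auto simp: cp_returns_def)
    have "z \<in> bilevel_feasible I" using sep[OF p \<epsilon>(2) cs(2,3)] .
    \<comment> \<open>The final relaxation still contains all bilevel feasible points, so its
      optimum bounds their objective from below.\<close>
    moreover have "leader_obj I z \<le> leader_obj I w" if "w \<in> bilevel_feasible I" for w
      using cs(2) bilevel_feasible_subset_R_feasible[OF cs(1) \<epsilon>(1)] that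
      by (auto simp: R_optimal_def)
    ultimately show ?thesis by (simp add: bilevel_optimal_def)
  qed
  show "\<exists>\<epsilon>0>0. \<forall>st. \<forall>p\<in>{1, 2}. \<forall>\<epsilon>. 0 < \<epsilon> \<and> \<epsilon> \<le> \<epsilon>0 \<longrightarrow>
            (\<forall>cs. cp_reachable I st p \<epsilon> cs \<longrightarrow>
               (\<forall>z\<in>R_optimal I cs. z \<notin> bilevel_feasible I \<longrightarrow>
                  (\<forall>out. separation I st p \<epsilon> (P_sys I cs) z out \<longrightarrow> (\<exists>c. out = Some c)))) \<and>
            (\<forall>z. cp_returns I st p \<epsilon> z \<longrightarrow> z \<in> bilevel_optimal I)"
  proof (intro exI[of _ \<epsilon>0] conjI allI ballI impI \<epsilon>0)
    fix st p \<epsilon> cs z out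
    assume "p \<in> {1, 2}" "0 < \<epsilon> \<and> \<epsilon> \<le> \<epsilon>0" "z \<in> R_optimal I cs" "z \<notin> bilevel_feasible I"
      and out: "separation I st p \<epsilon> (P_sys I cs) z out"
    then show "\<exists>c. out = Some c" using sep by (cases out) blast+
  qed (use opt in blast)
next
  show "\<forall>st. \<forall>p\<in>{1, 2}. \<forall>\<epsilon>>0.
            cp_terminates I st p \<epsilon> \<and>
            (\<forall>cs. cp_reachable I st p \<epsilon> cs \<longrightarrow>
               bilevel_feasible I \<subseteq> R_feasible I cs \<and>
               (R_feasible I cs \<noteq> {} \<longrightarrow> R_optimal I cs \<noteq> {}) \<and>
               (\<forall>z\<in>R_optimal I cs.
                  z extreme_point_of (convex hull (hpr_cont_feasible I)) \<and>
                  (\<exists>out. separation I st p \<epsilon> (P_sys I cs) z out) \<and>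
                  (\<forall>c. separation I st p \<epsilon> (P_sys I cs) z (Some c) \<longrightarrow>
                     disjunctive_cut I (sys_set I (P_sys I cs)) z c)))"
    by (intro allI ballI impI conjI cp_terminates_pos bilevel_feasible_subset_R_feasible
        R_optimal_nonempty hpr_feasible_extreme_point ex_separation separation_disjunctive_cut
        subsetD[OF R_optimal_subset_hpr])
qed

end
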